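(* Let $(K,\leq)$ be a partially ordered set, let $\{K_i \mid i\in I\}$ be the family of all maximal upward directed subsets of $K$, and let $\mathcal{F}=(K,\{\mathfrak{A}_a\},\{\sigma_{ba}\})$ be an inductive system of unital $C^*$-algebras over $K$ whose connecting maps are unital injective $*$-homomorphisms. Let $\mathfrak{A}^{K_i}$ and $\mathfrak{B}^{K_i}$ ($i\in I$) be the associated inductive limit $C^*$-algebras defined in the context. Then for every $i\in I$ the algebra $\mathfrak{A}^{K_i}$ is isomorphic to a subalgebra of $\mathfrak{B}^{K_i}$.
   Context: A subset $S$ of a partially ordered set $(K,\leq)$ is upward directed if it is non-empty and any two elements of $S$ have an upper bound in $S$. $\{K_i\mid i\in I\}$ is the family of all maximal (with respect to inclusion) upward directed subsets of $K$, with $K_i\neq K_j$ for $i\neq j$; one has $K=\bigcup_{i\in I}K_i$. For $a\in K$ put $U_a=\{i\in I\mid a\in K_i\}$. If $a\leq b$ then $U_b\subseteq U_a$. Inductive system: an inductive system of unital $C^*$-algebras over $K$ is a family $\{\mathfrak{A}_a\mid a\in K\}$ of unital $C^*$-algebras with unital $*$-homomorphisms $\sigma_{ba}:\mathfrak{A}_a\to\mathfrak{A}_b$ for all $a\leq b$ such that $\sigma_{aa}=\mathrm{id}$ and $\sigma_{ca}=\sigma_{cb}\circ\sigma_{ba}$ whenever $a\leq b\leq c$. Inductive limit: let $D$ be an upward directed set and $(D,\{\mathfrak{C}_a\},\{\rho_{ba}\})$ an inductive system of unital $C^*$-algebras over $D$. Let $\prod_{a\in D}\mathfrak{C}_a=\{(F_a)\mid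 \sup_a\|F_a\|<\infty\}$ with pointwise operations and supremum norm, and let $\Sigma$ be the closed two-sided ideal of all $(F_a)$ such that the net $\{\|F_a\|\}_{a\in D}$ converges to $0$. For $a\in D$ and $A\in\mathfrak{C}_a$ let $\theta_a(A)\in\prod_{b\in D}\mathfrak{C}_b$ be given by $[\theta_a(A)](b)=\rho_{ba}(A)$ if $a\leq b$ and $0$ otherwise, and let $\rho_a^{D}(A)=\theta_a(A)+\Sigma$. The inductive limit is the norm closure of $\bigcup_{a\in D}\rho_a^{D}(\mathfrak{C}_a)$ in $\prod_{a\in D}\mathfrak{C}_a/\Sigma$, together with the unital $*$-homomorphisms $\rho_a^{D}$. The algebra $\mathfrak{A}^{K_i}$ is the inductive limit of the restricted system $(K_i,\{\mathfrak{A}_a\}_{a\in K_i},\{\sigma_{ba}\})$. For $a\in K$ let $\mathfrak{B}_a=\prod_{i\in U_a}\mathfrak{A}^{K_i}$ (the $C^*$-algebra of norm-bounded families, supremum norm), and for $a\leq b$ let $\tau_{ba}:\mathfrak{B}_a\to\mathfrak{B}_b$ be the restriction map $\tau_{ba}(f)(j)=f(j)$, $j\in U_b$. Then $(K,\{\mathfrak{B}_a\},\{\tau_{ba}\})$ is an inductive system (the $\tau_{ba}$ need not be injective), and $\mathfrak{B}^{K_i}$ is the inductive limit of $(K_i,\{\mathfrak{B}_a\}_{a\in K_i},\{\tau_{ba}\})$. "Isomorphic" means $*$-isomorphic and "subalgebra" means $C^*$-subalgebra. *)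

theory Defs
  imports "HOL-Analysis.Analysis" "HOL-Algebra.QuotRing" "HOL-Algebra.Module"
begin

definition upward_directed :: "'k::order set \<Rightarrow> bool" where
  "upward_directed S \<longleftrightarrow> S \<noteq> {} \<and> (\<forall>x\<in>S. \<forall>y\<in>S. \<exists>z\<in>S. x \<le> z \<and> y \<le> z)"

definition maximal_directed :: "'k::order set \<Rightarrow> 'k set \<Rightarrow> bool" where
  "maximal_directed K S \<longleftrightarrow> S \<subseteq> K \<and> upward_directed S \<and>
     (\<forall>T. T \<subseteq> K \<and> upward_directed T \<and> S \<subseteq> T \<longrightarrow> T = S)"

text \<open>The filter on a directed set \<open>D\<close> generated by its tails: convergence along it is convergence
  of nets indexed by \<open>D\<close>.\<close>

definition tail_filter :: "'k::order set \<Rightarrow> 'k filter" where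
  "tail_filter D = (INF a\<in>D. principal {b\<in>D. a \<le> b})"

text \<open>The algebras of a system differ from index to index, and the limit algebras are carved out of
  quotients; so an algebra is a record with an explicit carrier, extending the rings and modules
  of HOL-Algebra. A family of algebras lives in one ambient type, which is no restriction since the
  carriers may be embedded in a disjoint union.\<close>

definition complex_ring :: "complex ring" where
  "complex_ring = \<lparr>carrier = UNIV, monoid.mult = (*), one = 1, ring.zero = 0, add = (+)\<rparr>"

record 'a cstar_struct = "(complex, 'a) module" +
  star :: "'a \<Rightarrow> 'a"
  cnorm :: "'a \<Rightarrow> real"

text \<open>The locale \<^locale>\<open>Metric_space\<close> asks for nonnegativity and symmetry also off the carrier,
  hence the case distinction.\<close>

definition cdist :: "('a, 'm) cstar_struct_scheme \<Rightarrow> 'a \<Rightarrow> 'a \<Rightarrow> real" where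
  "cdist A x y = (if x \<in> carrier A \<and> y \<in> carrier A then cnorm A (x \<ominus>\<^bsub>A\<^esub> y) else 0)"

definition norm_topology :: "('a, 'm) cstar_struct_scheme \<Rightarrow> 'a topology" where
  "norm_topology A = Metric_space.mtopology (carrier A) (cdist A)"

locale unital_cstar_algebra = ring A + module complex_ring A
  for A :: "('a, 'm) cstar_struct_scheme" (structure) +
  assumes smult_mult_left:
      "\<lbrakk>x \<in> carrier A; y \<in> carrier A\<rbrakk> \<Longrightarrow> (c \<odot> x) \<otimes> y = c \<odot> (x \<otimes> y)"
    and smult_mult_right:
      "\<lbrakk>x \<in> carrier A; y \<in> carrier A\<rbrakk> \<Longrightarrow> x \<otimes> (c \<odot> y) = c \<odot> (x \<otimes> y)"
    and star_closed: "x \<in> carrier A \<Longrightarrow> star A x \<in> carrier A"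
    and star_star: "x \<in> carrier A \<Longrightarrow> star A (star A x) = x"
    and star_add:
      "\<lbrakk>x \<in> carrier A; y \<in> carrier A\<rbrakk> \<Longrightarrow> star A (x \<oplus> y) = star A x \<oplus> star A y"
    and star_smult: "x \<in> carrier A \<Longrightarrow> star A (c \<odot> x) = cnj c \<odot> star A x"
    and star_mult:
      "\<lbrakk>x \<in> carrier A; y \<in> carrier A\<rbrakk> \<Longrightarrow> star A (x \<otimes> y) = star A y \<otimes> star A x"
    and cnorm_nonneg: "x \<in> carrier A \<Longrightarrow> 0 \<le> cnorm A x"
    and cnorm_eq_0_iff: "x \<in> carrier A \<Longrightarrow> cnorm A x = 0 \<longleftrightarrow> x = \<zero>"
    and cnorm_triangle:
      "\<lbrakk>x \<in> carrier A; y \<in> carrier A\<rbrakk> \<Longrightarrow> cnorm A (x \<oplus> y) \<le> cnorm A x + cnorm A y"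
    and cnorm_smult: "x \<in> carrier A \<Longrightarrow> cnorm A (c \<odot> x) = cmod c * cnorm A x"
    and cnorm_mult:
      "\<lbrakk>x \<in> carrier A; y \<in> carrier A\<rbrakk> \<Longrightarrow> cnorm A (x \<otimes> y) \<le> cnorm A x * cnorm A y"
    and cstar_identity: "x \<in> carrier A \<Longrightarrow> cnorm A (star A x \<otimes> x) = (cnorm A x)\<^sup>2"
    and complete: "Metric_space.mcomplete (carrier A) (cdist A)"

definition star_hom ::
  "('a, 'm) cstar_struct_scheme \<Rightarrow> ('b, 'n) cstar_struct_scheme \<Rightarrow> ('a \<Rightarrow> 'b) set" where
  "star_hom A B = {h \<in> carrier A \<rightarrow> carrier B.
     (\<forall>x\<in>carrier A. \<forall>y\<in>carrier A. h (x \<oplus>\<^bsub>A\<^esub> y) = h x \<oplus>\<^bsub>B\<^esub> h y) \<and>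
     (\<forall>x\<in>carrier A. \<forall>y\<in>carrier A. h (x \<otimes>\<^bsub>A\<^esub> y) = h x \<otimes>\<^bsub>B\<^esub> h y) \<and>
     (\<forall>c. \<forall>x\<in>carrier A. h (c \<odot>\<^bsub>A\<^esub> x) = c \<odot>\<^bsub>B\<^esub> h x) \<and>
     (\<forall>x\<in>carrier A. h (star A x) = star B (h x))}"

definition unital_star_hom ::
  "('a, 'm) cstar_struct_scheme \<Rightarrow> ('b, 'n) cstar_struct_scheme \<Rightarrow> ('a \<Rightarrow> 'b) set" where
  "unital_star_hom A B = {h \<in> star_hom A B. h \<one>\<^bsub>A\<^esub> = \<one>\<^bsub>B\<^esub>}"

definition star_isomorphic ::
  "('a, 'm) cstar_struct_scheme \<Rightarrow> ('b, 'n) cstar_struct_scheme \<Rightarrow> bool" where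
  "star_isomorphic A B \<longleftrightarrow> (\<exists>h\<in>star_hom A B. bij_betw h (carrier A) (carrier B))"

text \<open>A C*-subalgebra need not contain the unit of the ambient algebra.\<close>

definition cstar_subalgebra :: "'a set \<Rightarrow> ('a, 'm) cstar_struct_scheme \<Rightarrow> bool" where
  "cstar_subalgebra S B \<longleftrightarrow> S \<subseteq> carrier B \<and> \<zero>\<^bsub>B\<^esub> \<in> S \<and>
     (\<forall>x\<in>S. \<forall>y\<in>S. x \<oplus>\<^bsub>B\<^esub> y \<in> S) \<and>
     (\<forall>x\<in>S. \<forall>y\<in>S. x \<otimes>\<^bsub>B\<^esub> y \<in> S) \<and>
     (\<forall>c. \<forall>x\<in>S. c \<odot>\<^bsub>B\<^esub> x \<in> S) \<and>
     (\<forall>x\<in>S. star B x \<in> S) \<and>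
     closedin (norm_topology B) S"

text \<open>Families are normalised to \<^const>\<open>undefined\<close> outside the index set \<open>D\<close>. The norm is the intended
  one for nonempty \<open>D\<close>, the only case that occurs below.\<close>

definition bounded_prod ::
  "'k set \<Rightarrow> ('k \<Rightarrow> ('a, 'm) cstar_struct_scheme) \<Rightarrow> ('k \<Rightarrow> 'a) cstar_struct" where
  "bounded_prod D C = \<lparr>
     carrier = {F \<in> (\<Pi>\<^sub>E a\<in>D. carrier (C a)). bdd_above ((\<lambda>a. cnorm (C a) (F a)) ` D)},
     monoid.mult = (\<lambda>F G. \<lambda>a\<in>D. F a \<otimes>\<^bsub>C a\<^esub> G a),
     one = (\<lambda>a\<in>D. \<one>\<^bsub>C a\<^esub>),
     ring.zero = (\<lambda>a\<in>D. \<zero>\<^bsub>C a\<^esub>),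
     add = (\<lambda>F G. \<lambda>a\<in>D. F a \<oplus>\<^bsub>C a\<^esub> G a),
     smult = (\<lambda>c F. \<lambda>a\<in>D. c \<odot>\<^bsub>C a\<^esub> F a),
     star = (\<lambda>F. \<lambda>a\<in>D. star (C a) (F a)),
     cnorm = (\<lambda>F. SUP a\<in>D. cnorm (C a) (F a))\<rparr>"

text \<open>The operations on cosets are unions over representatives, in the style of
  \<^const>\<open>rcoset_mult\<close>; for a closed two-sided *-ideal each such union is a single coset.\<close>

definition quotient_cstar ::
  "('a, 'm) cstar_struct_scheme \<Rightarrow> 'a set \<Rightarrow> 'a set cstar_struct" where
  "quotient_cstar P J = \<lparr>
     carrier = carrier (P Quot J),
     monoid.mult = monoid.mult (P Quot J),
     one = one (P Quot J),
     ring.zero = ring.zero (P Quot J),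
     add = add (P Quot J),
     smult = (\<lambda>c X. \<Union>x\<in>X. J +>\<^bsub>P\<^esub> (c \<odot>\<^bsub>P\<^esub> x)),
     star = (\<lambda>X. \<Union>x\<in>X. J +>\<^bsub>P\<^esub> star P x),
     cnorm = (\<lambda>X. INF x\<in>X. cnorm P x)\<rparr>"

text \<open>As in \<open>\<sigma>\<^sub>b\<^sub>a\<close>, the target index comes first: \<open>\<sigma> b a\<close> maps \<open>A a\<close> to \<open>A b\<close>.\<close>

definition inductive_system ::
  "'k::order set \<Rightarrow> ('k \<Rightarrow> ('a, 'm) cstar_struct_scheme) \<Rightarrow> ('k \<Rightarrow> 'k \<Rightarrow> 'a \<Rightarrow> 'a) \<Rightarrow> bool" where
  "inductive_system K A \<sigma> \<longleftrightarrow>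
     (\<forall>a\<in>K. unital_cstar_algebra (A a)) \<and>
     (\<forall>a\<in>K. \<forall>b\<in>K. a \<le> b \<longrightarrow> \<sigma> b a \<in> unital_star_hom (A a) (A b)) \<and>
     (\<forall>a\<in>K. \<forall>x\<in>carrier (A a). \<sigma> a a x = x) \<and>
     (\<forall>a\<in>K. \<forall>b\<in>K. \<forall>c\<in>K. a \<le> b \<longrightarrow> b \<le> c \<longrightarrow>
        (\<forall>x\<in>carrier (A a). \<sigma> c a x = \<sigma> c b (\<sigma> b a x)))"

definition null_ideal ::
  "'k::order set \<Rightarrow> ('k \<Rightarrow> ('a, 'm) cstar_struct_scheme) \<Rightarrow> ('k \<Rightarrow> 'a) set" where
  "null_ideal D C = {F \<in> carrier (bounded_prod D C).
     ((\<lambda>a. cnorm (C a) (F a)) \<longlongrightarrow> 0) (tail_filter D)}"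

definition theta ::
  "'k::order set \<Rightarrow> ('k \<Rightarrow> ('a, 'm) cstar_struct_scheme) \<Rightarrow> ('k \<Rightarrow> 'k \<Rightarrow> 'a \<Rightarrow> 'a) \<Rightarrow>
     'k \<Rightarrow> 'a \<Rightarrow> 'k \<Rightarrow> 'a" where
  "theta D C \<rho> a x = (\<lambda>b\<in>D. if a \<le> b then \<rho> b a x else \<zero>\<^bsub>C b\<^esub>)"

definition limit_map ::
  "'k::order set \<Rightarrow> ('k \<Rightarrow> ('a, 'm) cstar_struct_scheme) \<Rightarrow> ('k \<Rightarrow> 'k \<Rightarrow> 'a \<Rightarrow> 'a) \<Rightarrow>
     'k \<Rightarrow> 'a \<Rightarrow> ('k \<Rightarrow> 'a) set" where
  "limit_map D C \<rho> a x = null_ideal D C +>\<^bsub>bounded_prod D C\<^esub> theta D C \<rho> a x"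

definition inductive_limit ::
  "'k::order set \<Rightarrow> ('k \<Rightarrow> ('a, 'm) cstar_struct_scheme) \<Rightarrow> ('k \<Rightarrow> 'k \<Rightarrow> 'a \<Rightarrow> 'a) \<Rightarrow>
     ('k \<Rightarrow> 'a) set cstar_struct" where
  "inductive_limit D C \<rho> =
     (let Q = quotient_cstar (bounded_prod D C) (null_ideal D C)
      in Q\<lparr>carrier :=
             norm_topology Q closure_of (\<Union>a\<in>D. limit_map D C \<rho> a ` carrier (C a))\<rparr>)"

definition U_set :: "'i set \<Rightarrow> ('i \<Rightarrow> 'k set) \<Rightarrow> 'k \<Rightarrow> 'i set" where
  "U_set I Ki a = {i \<in> I. a \<in> Ki i}"

definition A_limit ::
  "('i \<Rightarrow> 'k::order set) \<Rightarrow> ('k \<Rightarrow> ('a, 'm) cstar_struct_scheme) \<Rightarrow> ('k \<Rightarrow> 'k \<Rightarrow> 'a \<Rightarrow> 'a) \<Rightarrow>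
     'i \<Rightarrow> ('k \<Rightarrow> 'a) set cstar_struct" where
  "A_limit Ki A \<sigma> i = inductive_limit (Ki i) A \<sigma>"

definition B_alg ::
  "'i set \<Rightarrow> ('i \<Rightarrow> 'k::order set) \<Rightarrow> ('k \<Rightarrow> ('a, 'm) cstar_struct_scheme) \<Rightarrow>
     ('k \<Rightarrow> 'k \<Rightarrow> 'a \<Rightarrow> 'a) \<Rightarrow> 'k \<Rightarrow> ('i \<Rightarrow> ('k \<Rightarrow> 'a) set) cstar_struct" where
  "B_alg I Ki A \<sigma> a = bounded_prod (U_set I Ki a) (A_limit Ki A \<sigma>)"

definition tau :: "'i set \<Rightarrow> ('i \<Rightarrow> 'k set) \<Rightarrow> 'k \<Rightarrow> 'k \<Rightarrow> ('i \<Rightarrow> 'b) \<Rightarrow> 'i \<Rightarrow> 'b" where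
  "tau I Ki b a f = restrict f (U_set I Ki b)"

definition B_limit ::
  "'i set \<Rightarrow> ('i \<Rightarrow> 'k::order set) \<Rightarrow> ('k \<Rightarrow> ('a, 'm) cstar_struct_scheme) \<Rightarrow>
     ('k \<Rightarrow> 'k \<Rightarrow> 'a \<Rightarrow> 'a) \<Rightarrow> 'i \<Rightarrow> ('k \<Rightarrow> 'i \<Rightarrow> ('k \<Rightarrow> 'a) set) set cstar_struct" where
  "B_limit I Ki A \<sigma> i = inductive_limit (Ki i) (B_alg I Ki A \<sigma>) (tau I Ki)"

end

theory Submission
  imports Defs
begin

text \<open>Fix \<open>i\<close>. An element \<open>x\<close> of \<open>A a\<close> has an image in the limit algebra over every maximal directed
  set \<open>Ki j\<close> that contains \<open>a\<close>, and these images form a family \<open>diag a x\<close> in the product \<open>B_alg I Ki A \<sigma> a\<close>.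
  The maps \<open>diag a\<close>, for \<open>a\<close> in \<open>Ki i\<close>, are compatible with the connecting maps on both sides, so they
  induce a *-homomorphism from \<open>A_limit Ki A \<sigma> i\<close> to \<open>B_limit I Ki A \<sigma> i\<close>. It is isometric, and this is
  the whole theorem: an isometric image of a complete algebra is a closed subalgebra
  (\<open>isometric_star_hom_image\<close>), and inductive limits of complete algebras are complete
  (\<open>mcomplete_limit\<close>).

  Why it is isometric: the norm of the image of \<open>x\<close> in an inductive limit is the infimum of its norms
  at later indices \<open>b\<close> (\<open>limit_map_norm_le\<close>, \<open>limit_map_norm_approx\<close>). In the limit of the products,
  the norm at \<open>b\<close> is a supremum over all \<open>j\<close> with \<open>b\<close> in \<open>Ki j\<close>. As \<open>b\<close> runs through \<open>Ki i\<close>, the index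
  \<open>i\<close> always takes part in this supremum, and it contributes the norm of \<open>x\<close> in the limit over \<open>Ki i\<close>
  (\<open>limit_embedding_norm_ge\<close>). In the other direction all the maps involved are contractive.

  The one fact about C*-algebras that enters is that unital *-homomorphisms are contractive
  (\<open>unital_star_hom_contractive\<close>). It is derived without spectral theory: a self-adjoint element of
  norm below 1 is half the sum of an isometry and its adjoint (\<open>exists_isometry_half_sum\<close>), and
  homomorphisms preserve the defining relation of isometries. Everything else takes place in normed
  *-algebras, where products, quotients by closed *-ideals and closures of subalgebras can be formed
  and iterated freely.\<close>

section \<open>Normed *-algebras with explicit carriers\<close>

text \<open>Products, quotients by closed ideals and closures of subalgebras are all formed here, and iterated:
the algebras \<open>B_alg\<close> are products of limits, and the second limit is a quotient of a product of
those. The structures below are stable under all three constructions for elementary reasons. That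
is why the norm is only asked to make the involution isometric, a property that passes to quotients
at once, in contrast to the C*-identity.\<close>

locale star_algebra = ring A for A :: "('a, 'm) cstar_struct_scheme" (structure) +
  assumes smult_closed [simp]: "x \<in> carrier A \<Longrightarrow> c \<odot> x \<in> carrier A"
    and smult_add_left: "x \<in> carrier A \<Longrightarrow> (c + d) \<odot> x = c \<odot> x \<oplus> d \<odot> x"
    and smult_add_right:
      "\<lbrakk>x \<in> carrier A; y \<in> carrier A\<rbrakk> \<Longrightarrow> c \<odot> (x \<oplus> y) = c \<odot> x \<oplus> c \<odot> y"
    and smult_smult: "x \<in> carrier A \<Longrightarrow> c \<odot> (d \<odot> x) = (c * d) \<odot> x"
    and smult_one [simp]: "x \<in> carrier A \<Longrightarrow> 1 \<odot> x = x"
    and smult_mult_left: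
      "\<lbrakk>x \<in> carrier A; y \<in> carrier A\<rbrakk> \<Longrightarrow> (c \<odot> x) \<otimes> y = c \<odot> (x \<otimes> y)"
    and smult_mult_right:
      "\<lbrakk>x \<in> carrier A; y \<in> carrier A\<rbrakk> \<Longrightarrow> x \<otimes> (c \<odot> y) = c \<odot> (x \<otimes> y)"
    and star_closed [simp]: "x \<in> carrier A \<Longrightarrow> star A x \<in> carrier A"
    and star_star [simp]: "x \<in> carrier A \<Longrightarrow> star A (star A x) = x"
    and star_add:
      "\<lbrakk>x \<in> carrier A; y \<in> carrier A\<rbrakk> \<Longrightarrow> star A (x \<oplus> y) = star A x \<oplus> star A y"
    and star_smult: "x \<in> carrier A \<Longrightarrow> star A (c \<odot> x) = cnj c \<odot> star A x"
    and star_mult: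
      "\<lbrakk>x \<in> carrier A; y \<in> carrier A\<rbrakk> \<Longrightarrow> star A (x \<otimes> y) = star A y \<otimes> star A x"
begin

lemma smult_zero_left [simp]: "x \<in> carrier A \<Longrightarrow> 0 \<odot> x = \<zero>"
  using smult_add_left[of x 0 0] by (metis add.r_cancel_one' add_0 smult_closed)

lemma smult_zero_right [simp]: "c \<odot> \<zero> = \<zero>"
  using smult_add_right[of \<zero> \<zero> c] by (metis add.r_cancel_one' l_zero smult_closed zero_closed)

lemma minus_one_smult: "x \<in> carrier A \<Longrightarrow> (- 1) \<odot> x = \<ominus> x"
  using smult_add_left[of x "-1" 1] by (simp add: minus_equality)

lemma minus_eq_smult:
  "\<lbrakk>x \<in> carrier A; y \<in> carrier A\<rbrakk> \<Longrightarrow> x \<ominus> y = x \<oplus> (- 1) \<odot> y"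
  by (simp add: minus_one_smult minus_eq)

lemma star_zero [simp]: "star A \<zero> = \<zero>"
  using star_smult[of \<zero> 0] by simp

lemma star_one [simp]: "star A \<one> = \<one>"
proof -
  have "star A \<one> = star A \<one> \<otimes> star A (star A \<one>)" by simp
  also have "\<dots> = star A (star A \<one> \<otimes> \<one>)" by (subst star_mult) simp_all
  also have "\<dots> = \<one>" by simp
  finally show ?thesis .
qed

lemma star_minus:
  "\<lbrakk>x \<in> carrier A; y \<in> carrier A\<rbrakk> \<Longrightarrow> star A (x \<ominus> y) = star A x \<ominus> star A y"
  by (simp add: minus_eq_smult star_add star_smult)

lemma smult_minus:
  "\<lbrakk>x \<in> carrier A; y \<in> carrier A\<rbrakk> \<Longrightarrow> c \<odot> (x \<ominus> y) = c \<odot> x \<ominus> c \<odot> y"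
  by (simp add: minus_eq_smult smult_add_right smult_smult mult.commute)

end

text \<open>Multiplication by \<open>-1\<close> supplies the additive inverses, so that each of the three constructions
only has to check closure properties and equations.\<close>

lemma star_algebraI:
  fixes A :: "('a, 'm) cstar_struct_scheme" (structure)
  assumes closed: "\<zero> \<in> carrier A" "\<one> \<in> carrier A"
      "\<And>x y. \<lbrakk>x \<in> carrier A; y \<in> carrier A\<rbrakk> \<Longrightarrow> x \<oplus> y \<in> carrier A"
      "\<And>x y. \<lbrakk>x \<in> carrier A; y \<in> carrier A\<rbrakk> \<Longrightarrow> x \<otimes> y \<in> carrier A"
      "\<And>c x. x \<in> carrier A \<Longrightarrow> c \<odot> x \<in> carrier A"
      "\<And>x. x \<in> carrier A \<Longrightarrow> star A x \<in> carrier A"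
    and add: "\<And>x y z. \<lbrakk>x \<in> carrier A; y \<in> carrier A; z \<in> carrier A\<rbrakk> \<Longrightarrow> (x \<oplus> y) \<oplus> z = x \<oplus> (y \<oplus> z)"
      "\<And>x y. \<lbrakk>x \<in> carrier A; y \<in> carrier A\<rbrakk> \<Longrightarrow> x \<oplus> y = y \<oplus> x"
      "\<And>x. x \<in> carrier A \<Longrightarrow> \<zero> \<oplus> x = x"
    and mult: "\<And>x y z. \<lbrakk>x \<in> carrier A; y \<in> carrier A; z \<in> carrier A\<rbrakk> \<Longrightarrow> (x \<otimes> y) \<otimes> z = x \<otimes> (y \<otimes> z)"
      "\<And>x. x \<in> carrier A \<Longrightarrow> \<one> \<otimes> x = x"
      "\<And>x. x \<in> carrier A \<Longrightarrow> x \<otimes> \<one> = x"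
      "\<And>x y z. \<lbrakk>x \<in> carrier A; y \<in> carrier A; z \<in> carrier A\<rbrakk> \<Longrightarrow> (x \<oplus> y) \<otimes> z = x \<otimes> z \<oplus> y \<otimes> z"
      "\<And>x y z. \<lbrakk>x \<in> carrier A; y \<in> carrier A; z \<in> carrier A\<rbrakk> \<Longrightarrow> z \<otimes> (x \<oplus> y) = z \<otimes> x \<oplus> z \<otimes> y"
    and smult: "\<And>c d x. x \<in> carrier A \<Longrightarrow> (c + d) \<odot> x = c \<odot> x \<oplus> d \<odot> x"
      "\<And>c x y. \<lbrakk>x \<in> carrier A; y \<in> carrier A\<rbrakk> \<Longrightarrow> c \<odot> (x \<oplus> y) = c \<odot> x \<oplus> c \<odot> y"
      "\<And>c d x. x \<in> carrier A \<Longrightarrow> c \<odot> (d \<odot> x) = (c * d) \<odot> x"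
      "\<And>x. x \<in> carrier A \<Longrightarrow> 1 \<odot> x = x"
      "\<And>x. x \<in> carrier A \<Longrightarrow> 0 \<odot> x = \<zero>"
      "\<And>c x y. \<lbrakk>x \<in> carrier A; y \<in> carrier A\<rbrakk> \<Longrightarrow> (c \<odot> x) \<otimes> y = c \<odot> (x \<otimes> y)"
      "\<And>c x y. \<lbrakk>x \<in> carrier A; y \<in> carrier A\<rbrakk> \<Longrightarrow> x \<otimes> (c \<odot> y) = c \<odot> (x \<otimes> y)"
    and star: "\<And>x. x \<in> carrier A \<Longrightarrow> star A (star A x) = x"
      "\<And>x y. \<lbrakk>x \<in> carrier A; y \<in> carrier A\<rbrakk> \<Longrightarrow> star A (x \<oplus> y) = star A x \<oplus> star A y"
      "\<And>c x. x \<in> carrier A \<Longrightarrow> star A (c \<odot> x) = cnj c \<odot> star A x"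
      "\<And>x y. \<lbrakk>x \<in> carrier A; y \<in> carrier A\<rbrakk> \<Longrightarrow> star A (x \<otimes> y) = star A y \<otimes> star A x"
  shows "star_algebra A"
proof -
  have "abelian_group A"
  proof (rule abelian_groupI)
    fix x assume x: "x \<in> carrier A"
    have "((- 1) \<odot> x) \<oplus> x = (- 1 + 1) \<odot> x" by (simp only: smult(1,4) x)
    then show "\<exists>y\<in>carrier A. y \<oplus> x = \<zero>" using x closed(5) smult(5) by force
  qed (use closed add in auto)
  moreover have "monoid A" by (rule monoidI) (use closed mult in auto)
  ultimately have "ring A" by (intro ringI) (use mult in auto)
  then interpret ring A .
  show ?thesis
    by unfold_locales (use closed smult star in auto)
qed

locale normed_star_algebra = star_algebra A for A :: "('a, 'm) cstar_struct_scheme" (structure) +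
  assumes norm_nonneg [simp]: "x \<in> carrier A \<Longrightarrow> 0 \<le> cnorm A x"
    and norm_eq_zero: "\<lbrakk>x \<in> carrier A; cnorm A x = 0\<rbrakk> \<Longrightarrow> x = \<zero>"
    and norm_triangle:
      "\<lbrakk>x \<in> carrier A; y \<in> carrier A\<rbrakk> \<Longrightarrow> cnorm A (x \<oplus> y) \<le> cnorm A x + cnorm A y"
    and norm_smult: "x \<in> carrier A \<Longrightarrow> cnorm A (c \<odot> x) = cmod c * cnorm A x"
    and norm_mult:
      "\<lbrakk>x \<in> carrier A; y \<in> carrier A\<rbrakk> \<Longrightarrow> cnorm A (x \<otimes> y) \<le> cnorm A x * cnorm A y"
    and norm_star [simp]: "x \<in> carrier A \<Longrightarrow> cnorm A (star A x) = cnorm A x"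
    and norm_one: "cnorm A \<one> \<le> 1"
begin

lemma norm_zero [simp]: "cnorm A \<zero> = 0"
  using norm_smult[of \<zero> 0] by simp

lemma norm_minus_commute:
  assumes "x \<in> carrier A" "y \<in> carrier A"
  shows "cnorm A (x \<ominus> y) = cnorm A (y \<ominus> x)"
proof -
  have "x \<ominus> y = (- 1) \<odot> (y \<ominus> x)"
    using assms by (simp add: minus_eq_smult smult_add_right smult_smult a_comm)
  then show ?thesis using assms by (simp add: norm_smult)
qed

lemma minus_add_minus:
  "\<lbrakk>x \<in> carrier A; y \<in> carrier A; z \<in> carrier A\<rbrakk> \<Longrightarrow> (x \<ominus> y) \<oplus> (y \<ominus> z) = x \<ominus> z"
  by (simp add: minus_eq a_assoc r_neg2 r_neg1)

lemma norm_minus_triangle: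
  assumes "x \<in> carrier A" "y \<in> carrier A" "z \<in> carrier A"
  shows "cnorm A (x \<ominus> z) \<le> cnorm A (x \<ominus> y) + cnorm A (y \<ominus> z)"
  using norm_triangle[of "x \<ominus> y" "y \<ominus> z"] assms by (simp add: minus_add_minus)

lemma norm_le_norm_minus:
  assumes "x \<in> carrier A" "y \<in> carrier A"
  shows "cnorm A x \<le> cnorm A (x \<ominus> y) + cnorm A y"
  using norm_minus_triangle[of x y \<zero>] assms by (simp add: minus_eq)

lemma minus_self [simp]: "x \<in> carrier A \<Longrightarrow> x \<ominus> x = \<zero>"
  by (simp add: minus_eq r_neg)

lemma minus_eq_zero_iff:
  "\<lbrakk>x \<in> carrier A; y \<in> carrier A\<rbrakk> \<Longrightarrow> x \<ominus> y = \<zero> \<longleftrightarrow> x = y"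
  by (metis a_minus_def add.inv_closed minus_equality r_neg)

sublocale metric: Metric_space "carrier A" "cdist A"
proof
  fix x y z
  show "0 \<le> cdist A x y" by (simp add: cdist_def)
  show "cdist A x y = cdist A y x" by (simp add: cdist_def norm_minus_commute)
  show "cdist A x y = 0 \<longleftrightarrow> x = y" if "x \<in> carrier A" "y \<in> carrier A"
    using that norm_eq_zero[of "x \<ominus> y"] by (auto simp: cdist_def minus_eq_zero_iff)
  show "cdist A x z \<le> cdist A x y + cdist A y z"
    if "x \<in> carrier A" "y \<in> carrier A" "z \<in> carrier A"
    using that by (simp add: cdist_def norm_minus_triangle)
qed

lemma norm_topology_eq: "norm_topology A = metric.mtopology"
  by (simp add: norm_topology_def)

text \<open>Sequential convergence on the carrier. The closure that defines the inductive limit, the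
completeness of the given algebras and the closedness of the image are all used through it, which
reduces the topology to limits of real sequences.\<close>

definition tends :: "(nat \<Rightarrow> 'a) \<Rightarrow> 'a \<Rightarrow> bool" where
  "tends X x \<longleftrightarrow> (\<forall>n. X n \<in> carrier A) \<and> x \<in> carrier A \<and> (\<lambda>n. cnorm A (X n \<ominus> x)) \<longlonglongrightarrow> 0"

lemma tendsD: 
  assumes "tends X x" 
  shows "X n \<in> carrier A" "x \<in> carrier A" "(\<lambda>n. cnorm A (X n \<ominus> x)) \<longlonglongrightarrow> 0"
  using assms by (auto simp: tends_def)

lemma tends_iff_limitin:
  assumes "\<And>n. X n \<in> carrier A"
  shows "limitin metric.mtopology X x sequentially \<longleftrightarrow> tends X x"
  using assms by (auto simp: metric.limitin_metric_dist_null tends_def cdist_def cong: conj_cong)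

lemma tendsI:
  assumes "\<And>n. X n \<in> carrier A" "x \<in> carrier A" "f \<longlonglongrightarrow> 0" "\<And>n. cnorm A (X n \<ominus> x) \<le> f n"
  shows "tends X x"
  unfolding tends_def using assms
  by (auto intro: tendsto_sandwich[of "\<lambda>_. 0" _ _ f])

lemma tends_unique: "tends X x \<Longrightarrow> tends X y \<Longrightarrow> x = y"
  by (metis metric.limitin_metric_unique sequentially_bot tends_iff_limitin tendsD(1))

lemma tends_const: "x \<in> carrier A \<Longrightarrow> tends (\<lambda>_. x) x"
  by (simp add: tends_def minus_eq r_neg)

lemma tends_norm: 
  assumes "tends X x"
  shows "(\<lambda>n. cnorm A (X n)) \<longlonglongrightarrow> cnorm A x"
proof (rule tendsto_dist_iff[THEN iffD2], rule tendsto_sandwich[OF _ _ tendsto_const tendsD(3)[OF assms]])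
  note [simp] = tendsD(1,2)[OF assms]
  show "\<forall>\<^sub>F n in sequentially. dist (cnorm A (X n)) (cnorm A x) \<le> cnorm A (X n \<ominus> x)"
    using norm_le_norm_minus[of "X _" x] norm_le_norm_minus[of x "X _"] 
    by (intro always_eventually) (auto simp: dist_real_def abs_le_iff norm_minus_commute[of x] algebra_simps)
qed simp

lemma tends_add:
  assumes X: "tends X x" and Y: "tends Y y"
  shows "tends (\<lambda>n. X n \<oplus> Y n) (x \<oplus> y)"
proof -
  note [simp] = tendsD(1,2)[OF X] tendsD(1,2)[OF Y]
  have eq: "(X n \<oplus> Y n) \<ominus> (x \<oplus> y) = (X n \<ominus> x) \<oplus> (Y n \<ominus> y)" for n
    by (simp add: minus_eq minus_add a_ac)
  show ?thesis
  proof (rule tendsI)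
    show "(\<lambda>n. cnorm A (X n \<ominus> x) + cnorm A (Y n \<ominus> y)) \<longlonglongrightarrow> 0"
      using tendsto_add[OF tendsD(3)[OF X] tendsD(3)[OF Y]] by simp
    show "cnorm A ((X n \<oplus> Y n) \<ominus> (x \<oplus> y)) \<le> cnorm A (X n \<ominus> x) + cnorm A (Y n \<ominus> y)" for n
      unfolding eq by (rule norm_triangle) simp_all
  qed simp_all
qed

lemma tends_smult:
  assumes X: "tends X x"
  shows "tends (\<lambda>n. c \<odot> X n) (c \<odot> x)"
proof -
  note [simp] = tendsD(1,2)[OF X]
  show ?thesis
  proof (rule tendsI)
    show "(\<lambda>n. cmod c * cnorm A (X n \<ominus> x)) \<longlonglongrightarrow> 0"
      using tendsto_mult[OF tendsto_const tendsD(3)[OF X]] by simp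
  qed (simp_all flip: smult_minus add: norm_smult)
qed

lemma tends_star:
  assumes X: "tends X x"
  shows "tends (\<lambda>n. star A (X n)) (star A x)"
  using tendsD[OF X] by (simp add: tends_def flip: star_minus)

lemma tends_mult:
  assumes X: "tends X x" and Y: "tends Y y"
  shows "tends (\<lambda>n. X n \<otimes> Y n) (x \<otimes> y)"
proof -
  note [simp] = tendsD(1,2)[OF X] tendsD(1,2)[OF Y]
  have eq: "(X n \<otimes> Y n) \<ominus> (x \<otimes> y) = X n \<otimes> (Y n \<ominus> y) \<oplus> (X n \<ominus> x) \<otimes> y" for n
    using minus_add_minus[of "X n \<otimes> Y n" "X n \<otimes> y" "x \<otimes> y"]
    by (simp add: minus_eq_smult l_distr r_distr smult_mult_left smult_mult_right)
  show ?thesis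
  proof (rule tendsI)
    show "(\<lambda>n. cnorm A (X n) * cnorm A (Y n \<ominus> y) + cnorm A (X n \<ominus> x) * cnorm A y) \<longlonglongrightarrow> 0"
      using tendsto_add[OF tendsto_mult[OF tends_norm[OF X] tendsD(3)[OF Y]]
          tendsto_mult[OF tendsD(3)[OF X] tendsto_const]] by simp
    show "cnorm A ((X n \<otimes> Y n) \<ominus> (x \<otimes> y))
        \<le> cnorm A (X n) * cnorm A (Y n \<ominus> y) + cnorm A (X n \<ominus> x) * cnorm A y" for n
      unfolding eq by (rule order_trans[OF norm_triangle]) (auto intro!: add_mono norm_mult)
  qed simp_all
qed

definition norm_Cauchy :: "(nat \<Rightarrow> 'a) \<Rightarrow> bool" where
  "norm_Cauchy X \<longleftrightarrow> (\<forall>n. X n \<in> carrier A) \<and> 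
     (\<forall>e>0. \<exists>N. \<forall>m\<ge>N. \<forall>n\<ge>N. cnorm A (X m \<ominus> X n) < e)"

lemma norm_Cauchy_iff_MCauchy: "norm_Cauchy X \<longleftrightarrow> metric.MCauchy X"
  unfolding norm_Cauchy_def metric.MCauchy_def
  by (auto simp: cdist_def image_subset_iff)

lemma norm_complete_iff:
  "metric.mcomplete \<longleftrightarrow> (\<forall>X. norm_Cauchy X \<longrightarrow> (\<exists>x. tends X x))"
  unfolding metric.mcomplete_def norm_Cauchy_iff_MCauchy
  using tends_iff_limitin metric.MCauchy_def by (metis range_subsetD)

lemma norm_Cauchy_geometric:
  assumes X: "\<And>n. X n \<in> carrier A" and q: "0 \<le> q" "q < 1"
    and step: "\<And>n. cnorm A (X (Suc n) \<ominus> X n) \<le> C * q ^ n"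
  shows "norm_Cauchy X"
proof -
  note [simp] = X
  have C: "0 \<le> C" 
    using norm_nonneg[of "X (Suc 0) \<ominus> X 0"] step[of 0] by (simp del: norm_nonneg)
  have tail: "cnorm A (X (m + k) \<ominus> X m) \<le> (\<Sum>i<k. C * q ^ (m + i))" for m k
  proof (induction k)
    case (Suc k)
    then show ?case
      using norm_minus_triangle[of "X (m + Suc k)" "X (m + k)" "X m"] step[of "m + k"] by simp
  qed (simp add: minus_eq r_neg)
  have geo: "(\<Sum>i<k. C * q ^ (m + i)) \<le> C * q ^ m / (1 - q)" for m k
  proof -
    have "(\<Sum>i<k. q ^ i) \<le> 1 / (1 - q)"
      using sum_le_suminf[of "\<lambda>i. q ^ i" "{..<k}"] q suminf_geometric[of q] by (simp add: summable_geometric)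
    from mult_left_mono[OF this, of "C * q ^ m"] C q show ?thesis
      by (simp add: sum_distrib_left power_add mult.assoc)
  qed
  have lim: "(\<lambda>m. C * q ^ m / (1 - q)) \<longlonglongrightarrow> 0"
    using tendsto_mult[OF tendsto_const LIMSEQ_power_zero[of q], of "C / (1 - q)"] q by (simp add: mult.commute)
  show ?thesis unfolding norm_Cauchy_def
  proof (intro conjI allI impI)
    fix e :: real assume "e > 0"
    then obtain N where N: "\<And>m. m \<ge> N \<Longrightarrow> C * q ^ m / (1 - q) < e"
      using order_tendstoD(2)[OF lim] by (auto simp: eventually_sequentially)
    have *: "cnorm A (X n \<ominus> X m) < e" if "N \<le> m" "m \<le> n" for m n
      using tail[of m "n - m"] geo[of m "n - m"] N[OF that(1)] that(2) by simp
    show "\<exists>N. \<forall>m\<ge>N. \<forall>n\<ge>N. cnorm A (X m \<ominus> X n) < e"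
      using * norm_minus_commute[OF X X] by (metis linear)
  qed simp
qed

text \<open>Sequences with geometrically small steps are the ones that lift from a quotient to
representatives, so completeness is tested on them; a Cauchy sequence has such a subsequence.\<close>

lemma mcompleteI_geometric:
  assumes "\<And>X. (\<And>n. X n \<in> carrier A) \<Longrightarrow> (\<And>n. cnorm A (X (Suc n) \<ominus> X n) < (1/2) ^ n) 
      \<Longrightarrow> \<exists>x. tends X x"
  shows "metric.mcomplete"
  unfolding metric.mcomplete_def
proof (intro allI impI)
  fix X assume X: "metric.MCauchy X"
  then have cau: "\<And>n. X n \<in> carrier A" "\<And>e. e > 0 \<Longrightarrow> \<exists>N. \<forall>m\<ge>N. \<forall>n\<ge>N. cnorm A (X m \<ominus> X n) < e"
    by (auto simp: norm_Cauchy_def simp flip: norm_Cauchy_iff_MCauchy)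
  then have "\<forall>k. \<exists>N. \<forall>m\<ge>N. \<forall>n\<ge>N. cnorm A (X m \<ominus> X n) < (1/2) ^ k" by simp
  then obtain N where N: "\<And>k m n. m \<ge> N k \<Longrightarrow> n \<ge> N k \<Longrightarrow> cnorm A (X m \<ominus> X n) < (1/2) ^ k"
    by metis
  \<comment> \<open>strictly increasing, and beyond the threshold for \<open>(1/2) ^ k\<close> at stage \<open>k\<close>\<close>
  define r where "r = rec_nat (N 0) (\<lambda>k p. max (Suc p) (N (Suc k)))"
  have r: "strict_mono r" "\<And>k. N k \<le> r k"
  proof -
    show "strict_mono r" by (rule strict_mono_Suc_iff[THEN iffD2]) (auto simp: r_def)
    show "N k \<le> r k" for k by (cases k) (auto simp: r_def)
  qed
  have "\<exists>x. tends (X \<circ> r) x"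
  proof (rule assms)
    fix n
    have "r n < r (Suc n)" using r(1) by (simp add: strict_mono_Suc_iff)
    then show "cnorm A ((X \<circ> r) (Suc n) \<ominus> (X \<circ> r) n) < (1/2) ^ n"
      using N[of n] r(2)[of n] by simp
  qed (simp add: cau)
  then obtain x where "tends (X \<circ> r) x" by blast
  then have "limitin metric.mtopology (X \<circ> r) x sequentially"
    using cau(1) by (subst tends_iff_limitin) auto
  then show "\<exists>x. limitin metric.mtopology X x sequentially"
    using metric.MCauchy_convergent_subsequence[OF X r(1)] by blast
qed

lemma in_closure_iff:
  assumes "S \<subseteq> carrier A"
  shows "x \<in> norm_topology A closure_of S \<longleftrightarrow> (\<exists>X. (\<forall>n. X n \<in> S) \<and> tends X x)"
  unfolding norm_topology_eq metric.closure_of_sequentially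
  using assms tends_iff_limitin tendsD by (auto simp: image_subset_iff)

lemma closedin_norm_topologyI:
  assumes "S \<subseteq> carrier A" "\<And>X x. (\<And>n. X n \<in> S) \<Longrightarrow> tends X x \<Longrightarrow> x \<in> S"
  shows "closedin (norm_topology A) S"
  unfolding norm_topology_eq metric.metric_closedin_iff_sequentially_closed
  using assms tends_iff_limitin by (metis subset_iff rangeI)

end

section \<open>Unital *-homomorphisms of C*-algebras are contractive\<close>

lemma (in unital_cstar_algebra) cstar_norm_star:
  assumes "x \<in> carrier A"
  shows "cnorm A (star A x) = cnorm A x"
proof -
  have le: "cnorm A y \<le> cnorm A (star A y)" if y: "y \<in> carrier A" for y
  proof (cases "cnorm A y = 0")
    case False
    have "cnorm A y * cnorm A y \<le> cnorm A (star A y) * cnorm A y"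
      using cnorm_mult[of "star A y" y] y by (simp add: cstar_identity star_closed power2_eq_square)
    then show ?thesis using False cnorm_nonneg[OF y] by (simp add: mult_le_cancel_right)
  qed (use y cnorm_nonneg star_closed in simp)
  show ?thesis using le[OF assms] le[of "star A x"] assms by (simp add: star_closed star_star)
qed

lemma normed_star_algebra_of_cstar:
  assumes "unital_cstar_algebra A"
  shows "normed_star_algebra A"
proof -
  interpret unital_cstar_algebra A by fact
  have sa: "star_algebra A"
    by unfold_locales 
      (use smult_closed smult_l_distr smult_r_distr smult_assoc1 smult_one smult_mult_left smult_mult_right 
        star_closed star_star star_add star_smult star_mult in \<open>auto simp: complex_ring_def\<close>)
  interpret sa: star_algebra A by (rule sa)
  have "cnorm A \<one>\<^bsub>A\<^esub> = (cnorm A \<one>\<^bsub>A\<^esub>)\<^sup>2"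
    using cstar_identity[of "\<one>\<^bsub>A\<^esub>"] by simp
  then have one: "cnorm A \<one>\<^bsub>A\<^esub> \<le> 1" by (auto simp: power2_eq_square)
  show ?thesis
    by unfold_locales
      (use cnorm_nonneg cnorm_eq_0_iff cnorm_triangle cnorm_smult cnorm_mult cstar_norm_star one in auto)
qed

lemma star_homD:
  assumes "h \<in> star_hom A B"
  shows "x \<in> carrier A \<Longrightarrow> h x \<in> carrier B"
    "\<lbrakk>x \<in> carrier A; y \<in> carrier A\<rbrakk> \<Longrightarrow> h (x \<oplus>\<^bsub>A\<^esub> y) = h x \<oplus>\<^bsub>B\<^esub> h y"
    "\<lbrakk>x \<in> carrier A; y \<in> carrier A\<rbrakk> \<Longrightarrow> h (x \<otimes>\<^bsub>A\<^esub> y) = h x \<otimes>\<^bsub>B\<^esub> h y"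
    "x \<in> carrier A \<Longrightarrow> h (c \<odot>\<^bsub>A\<^esub> x) = c \<odot>\<^bsub>B\<^esub> h x"
    "x \<in> carrier A \<Longrightarrow> h (star A x) = star B (h x)"
  using assms by (auto simp: star_hom_def)

lemma star_hom_zero:
  assumes "star_algebra A" "star_algebra B" "h \<in> star_hom A B"
  shows "h \<zero>\<^bsub>A\<^esub> = \<zero>\<^bsub>B\<^esub>"
proof -
  interpret A: star_algebra A by fact
  interpret B: star_algebra B by fact
  show ?thesis
    using star_homD(4)[OF assms(3) A.zero_closed, of 0] star_homD(1)[OF assms(3) A.zero_closed] by simp
qed

lemma star_hom_minus:
  assumes "star_algebra A" "star_algebra B" "h \<in> star_hom A B" "x \<in> carrier A" "y \<in> carrier A"
  shows "h (x \<ominus>\<^bsub>A\<^esub> y) = h x \<ominus>\<^bsub>B\<^esub> h y"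
proof -
  interpret A: star_algebra A by fact
  interpret B: star_algebra B by fact
  show ?thesis
    using assms(4,5) by (simp add: A.minus_eq_smult B.minus_eq_smult star_homD[OF assms(3)])
qed

text \<open>This is \<open>y = cos \<theta> = (e\<^sup>i\<^sup>\<theta> + e\<^sup>-\<^sup>i\<^sup>\<theta>) / 2\<close> without functional calculus: the element
\<open>w = y + \<i> z\<close> with \<open>z = sqrt (1 - y\<^sup>2)\<close> does it, provided that \<open>z\<close> is self-adjoint and commutes
with \<open>y\<close>. Writing \<open>z = 1 - t\<close>, the equation \<open>z\<^sup>2 = 1 - y\<^sup>2\<close> becomes the fixed-point equation
\<open>t = (y\<^sup>2 + t\<^sup>2) / 2\<close>, whose right-hand side maps the ball of radius \<open>q = \<parallel>y\<^sup>2\<parallel> < 1\<close> to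
itself and is a contraction there with constant \<open>q\<close>. All iterates from \<open>0\<close> are self-adjoint and
commute with \<open>y\<close>, hence so does the limit.\<close>

lemma (in normed_star_algebra) exists_isometry_half_sum:
  assumes complete: "metric.mcomplete"
    and y: "y \<in> carrier A" "star A y = y" "cnorm A y < 1"
  shows "\<exists>w\<in>carrier A. star A w \<otimes> w = \<one> \<and> y = (1/2) \<odot> (w \<oplus> star A w)"
proof -
  note [simp] = y(1,2)
  define s where "s = y \<otimes> y"
  define q where "q = cnorm A s"
  define f where "f t = (1/2) \<odot> (s \<oplus> t \<otimes> t)" for t
  have s [simp]: "s \<in> carrier A" "star A s = s" by (simp_all add: s_def star_mult)
  have q: "0 \<le> q" "q < 1"
  proof -
    show "0 \<le> q" by (simp add: q_def)
    have "q \<le> cnorm A y * cnorm A y" by (simp add: q_def s_def norm_mult)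
    also have "\<dots> \<le> cnorm A y * 1" using y(3) by (intro mult_left_mono) auto
    finally show "q < 1" using y(3) by simp
  qed
  define T where "T n = (f ^^ n) \<zero>" for n
  have T_Suc: "T (Suc n) = f (T n)" for n by (simp add: T_def)
  have T: "T n \<in> carrier A \<and> star A (T n) = T n \<and> T n \<otimes> y = y \<otimes> T n \<and> cnorm A (T n) \<le> q" for n
  proof (induction n)
    case 0
    show ?case using q by (simp add: T_def)
  next
    case (Suc n)
    define t where "t = T n"
    have t [simp]: "t \<in> carrier A" "star A t = t" and ty: "t \<otimes> y = y \<otimes> t" and tq: "cnorm A t \<le> q"
      using Suc by (auto simp: t_def)
    have "(t \<otimes> t) \<otimes> y = y \<otimes> (t \<otimes> t)"
      using t(1) y(1) ty by (metis m_assoc)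
    moreover have "s \<otimes> y = y \<otimes> s" by (simp add: s_def m_assoc)
    ultimately have comm: "f t \<otimes> y = y \<otimes> f t"
      by (simp add: f_def smult_mult_left smult_mult_right l_distr r_distr)
    have "cnorm A (t \<otimes> t) \<le> q * 1"
      using norm_mult[of t t] mult_mono[of "cnorm A t" q "cnorm A t" 1] tq q by simp
    then have "cnorm A (f t) \<le> q"
      using norm_triangle[of s "t \<otimes> t"] by (simp add: f_def norm_smult q_def)
    then show ?case
      unfolding T_Suc using comm
      by (simp add: t_def[symmetric]) (simp add: f_def star_smult star_add star_mult)
  qed
  then have T_simps [simp]: "\<And>n. T n \<in> carrier A" "\<And>n. star A (T n) = T n" by auto
  have step: "cnorm A (T (Suc (Suc n)) \<ominus> T (Suc n)) \<le> q * cnorm A (T (Suc n) \<ominus> T n)" for n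
  proof -
    define t u where "t = T (Suc n)" and "u = T n"
    have [simp]: "t \<in> carrier A" "u \<in> carrier A" by (simp_all add: t_def u_def)
    have "cnorm A t \<le> q" "cnorm A u \<le> q" unfolding t_def u_def using T by auto
    have "f t \<ominus> f u = (1/2) \<odot> ((s \<oplus> t \<otimes> t) \<ominus> (s \<oplus> u \<otimes> u))"
      by (simp add: f_def smult_minus)
    also have "(s \<oplus> t \<otimes> t) \<ominus> (s \<oplus> u \<otimes> u) = t \<otimes> t \<ominus> u \<otimes> u"
      by (simp add: minus_eq minus_add a_ac r_neg1 r_neg2)
    also have "t \<otimes> t \<ominus> u \<otimes> u = t \<otimes> (t \<ominus> u) \<oplus> (t \<ominus> u) \<otimes> u"
      using minus_add_minus[of "t \<otimes> t" "t \<otimes> u" "u \<otimes> u"]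
      by (simp add: minus_eq_smult l_distr r_distr smult_mult_left smult_mult_right)
    finally have "cnorm A (f t \<ominus> f u) \<le> (cnorm A (t \<otimes> (t \<ominus> u)) + cnorm A ((t \<ominus> u) \<otimes> u)) / 2"
      using norm_triangle[of "t \<otimes> (t \<ominus> u)" "(t \<ominus> u) \<otimes> u"] by (simp add: norm_smult)
    also have "cnorm A (t \<otimes> (t \<ominus> u)) \<le> q * cnorm A (t \<ominus> u)"
      using \<open>cnorm A t \<le> q\<close> by (intro order_trans[OF norm_mult] mult_right_mono) simp_all
    also have "cnorm A ((t \<ominus> u) \<otimes> u) \<le> q * cnorm A (t \<ominus> u)"
      using \<open>cnorm A u \<le> q\<close> 
      by (subst mult.commute, intro order_trans[OF norm_mult] mult_left_mono) simp_all
    finally show ?thesis by (simp add: T_Suc[symmetric] t_def u_def)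
  qed
  have "cnorm A (T (Suc n) \<ominus> T n) \<le> cnorm A (T 1 \<ominus> T 0) * q ^ n" for n
  proof (induction n)
    case (Suc n)
    show ?case using order_trans[OF step mult_left_mono[OF Suc q(1)]] by (simp add: mult_ac)
  qed simp
  then have "norm_Cauchy T" using q by (intro norm_Cauchy_geometric) auto
  then obtain t where lim: "tends T t" using complete unfolding norm_complete_iff by blast
  have [simp]: "t \<in> carrier A" using tendsD[OF lim] by blast
  have star_t [simp]: "star A t = t"
    using tends_unique[OF tends_star[OF lim]] lim by simp
  have ty: "t \<otimes> y = y \<otimes> t"
  proof (rule tends_unique)
    show "tends (\<lambda>n. T n \<otimes> y) (t \<otimes> y)" by (intro tends_mult lim tends_const) simp
    show "tends (\<lambda>n. T n \<otimes> y) (y \<otimes> t)" using T by (simp add: tends_mult lim tends_const)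
  qed
  have "tends (\<lambda>n. f (T n)) (f t)" unfolding f_def
    by (intro tends_smult tends_add tends_mult lim tends_const) simp
  moreover have "tends (\<lambda>n. f (T n)) t"
    using lim unfolding tends_def T_Suc[symmetric] by (auto intro: LIMSEQ_Suc)
  ultimately have fix_t: "f t = t" by (rule tends_unique)
  define z where "z = \<one> \<ominus> t"
  have [simp]: "z \<in> carrier A" "star A z = z" by (simp_all add: z_def star_minus)
  have zy: "z \<otimes> y = y \<otimes> z" 
    using ty by (simp add: z_def minus_eq_smult l_distr r_distr smult_mult_left smult_mult_right)
  have "2 \<odot> t = 2 \<odot> f t" by (simp add: fix_t)
  also have "\<dots> = s \<oplus> t \<otimes> t" by (simp add: f_def smult_smult)
  finally have tt: "2 \<odot> t = s \<oplus> t \<otimes> t" .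
  have "s \<oplus> z \<otimes> z = (s \<oplus> t \<otimes> t) \<oplus> (\<one> \<oplus> (- 1) \<odot> t \<oplus> (- 1) \<odot> t)"
    by (simp add: z_def minus_eq_smult l_distr r_distr smult_mult_left smult_mult_right smult_add_right smult_smult a_ac)
  also have "\<dots> = \<one> \<oplus> (2 \<odot> t \<oplus> ((- 1) \<odot> t \<oplus> (- 1) \<odot> t))"
    by (simp add: tt[symmetric] a_ac)
  also have "\<dots> = \<one>" by (simp flip: smult_add_left)
  finally have sz: "s \<oplus> z \<otimes> z = \<one>" .
  define w where "w = y \<oplus> \<i> \<odot> z"
  have w [simp]: "w \<in> carrier A" by (simp add: w_def)
  have star_w: "star A w = y \<oplus> (- \<i>) \<odot> z" by (simp add: w_def star_add star_smult)
  have "star A w \<otimes> w = (s \<oplus> z \<otimes> z) \<oplus> (\<i> \<odot> (y \<otimes> z) \<oplus> (- \<i>) \<odot> (y \<otimes> z))"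
    unfolding star_w unfolding w_def s_def
    by (simp add: l_distr r_distr smult_mult_left smult_mult_right smult_add_right smult_smult zy a_ac)
  then have "star A w \<otimes> w = \<one>" by (simp add: sz flip: smult_add_left)
  moreover have "(1/2) \<odot> (w \<oplus> star A w) = y"
  proof -
    have "w \<oplus> star A w = (y \<oplus> y) \<oplus> (\<i> \<odot> z \<oplus> (- \<i>) \<odot> z)"
      unfolding star_w unfolding w_def by (simp add: a_ac)
    also have "\<dots> = 2 \<odot> y"
      using smult_add_left[of y 1 1] smult_add_left[of z \<i> "- \<i>"] by simp
    finally show ?thesis by (simp add: smult_smult)
  qed
  ultimately show ?thesis using w by metis
qed

text \<open>The usual argument compares spectral radii. Here a self-adjoint \<open>y\<close> with \<open>\<parallel>y\<parallel> < 1\<close> is half the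
sum of a \<open>w\<close> with \<open>w\<^sup>* w = 1\<close> and its adjoint; the relation \<open>w\<^sup>* w = 1\<close> is preserved by \<open>h\<close>, and
the C*-identity of the target turns it into \<open>\<parallel>h w\<parallel> \<le> 1\<close>, so \<open>\<parallel>h y\<parallel> \<le> 1\<close>. The general case
follows by applying this to \<open>x\<^sup>* x\<close> and scaling.\<close>

lemma unital_star_hom_contractive:
  assumes A: "unital_cstar_algebra A" and B: "unital_cstar_algebra B"
    and h: "h \<in> unital_star_hom A B" and x: "x \<in> carrier A"
  shows "cnorm B (h x) \<le> cnorm A x"
proof -
  interpret NA: normed_star_algebra A by (rule normed_star_algebra_of_cstar[OF A])
  interpret NB: normed_star_algebra B by (rule normed_star_algebra_of_cstar[OF B])
  have hom: "h \<in> star_hom A B" and one: "h \<one>\<^bsub>A\<^esub> = \<one>\<^bsub>B\<^esub>"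
    using h by (auto simp: unital_star_hom_def)
  note hs = star_homD[OF hom]
  have sa: "cnorm B (h y) \<le> 1"
    if y: "y \<in> carrier A" "star A y = y" "cnorm A y < 1" for y
  proof -
    obtain w where [simp]: "w \<in> carrier A" and w: "star A w \<otimes>\<^bsub>A\<^esub> w = \<one>\<^bsub>A\<^esub>"
      and yw: "y = (1/2) \<odot>\<^bsub>A\<^esub> (w \<oplus>\<^bsub>A\<^esub> star A w)"
      using NA.exists_isometry_half_sum[OF unital_cstar_algebra.complete[OF A] y] by blast
    have [simp]: "h w \<in> carrier B" by (simp add: hs)
    have "star B (h w) \<otimes>\<^bsub>B\<^esub> h w = \<one>\<^bsub>B\<^esub>"
      using arg_cong[OF w, of h] by (simp add: hs one)
    then have "(cnorm B (h w))\<^sup>2 \<le> 1"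
      using unital_cstar_algebra.cstar_identity[OF B, of "h w"] NB.norm_one by simp
    then have "cnorm B (h w) \<le> 1" by (simp add: abs_square_le_1)
    moreover have "h y = (1/2) \<odot>\<^bsub>B\<^esub> (h w \<oplus>\<^bsub>B\<^esub> star B (h w))"
      by (simp add: yw hs)
    ultimately show ?thesis
      using NB.norm_triangle[of "h w" "star B (h w)"] by (simp add: NB.norm_smult)
  qed
  have unit_ball: "cnorm B (h y) \<le> 1" if y: "y \<in> carrier A" "cnorm A y < 1" for y
  proof -
    have "(cnorm A y)\<^sup>2 < 1" using y by (simp add: power_less_one_iff abs_square_less_1)
    then have "cnorm A (star A y \<otimes>\<^bsub>A\<^esub> y) < 1" using y by (simp add: unital_cstar_algebra.cstar_identity[OF A])
    then have "cnorm B (h (star A y \<otimes>\<^bsub>A\<^esub> y)) \<le> 1"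
      using y by (intro sa) (simp_all add: NA.star_mult)
    then have "(cnorm B (h y))\<^sup>2 \<le> 1" using y by (simp add: hs unital_cstar_algebra.cstar_identity[OF B])
    then show ?thesis using y by (simp add: abs_square_le_1 hs)
  qed
  show ?thesis
  proof (rule dense_ge)
    fix r assume r: "cnorm A x < r"
    then have "r > 0" using NA.norm_nonneg[OF x] by linarith
    have "cnorm B (h (complex_of_real (1 / r) \<odot>\<^bsub>A\<^esub> x)) \<le> 1"
      using x r \<open>r > 0\<close> by (intro unit_ball) (simp_all add: NA.norm_smult norm_divide)
    then show "cnorm B (h x) \<le> r"
      using x \<open>r > 0\<close> by (simp add: hs NB.norm_smult norm_divide field_simps)
  qed
qed

section \<open>Subalgebras, products and quotients\<close>

locale unital_star_subalgebra = normed_star_algebra A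
  for A :: "('a, 'm) cstar_struct_scheme" (structure) +
  fixes S :: "'a set"
  assumes sub_carrier: "S \<subseteq> carrier A"
    and sub_one: "\<one> \<in> S"
    and sub_add: "\<lbrakk>x \<in> S; y \<in> S\<rbrakk> \<Longrightarrow> x \<oplus> y \<in> S"
    and sub_mult: "\<lbrakk>x \<in> S; y \<in> S\<rbrakk> \<Longrightarrow> x \<otimes> y \<in> S"
    and sub_smult: "x \<in> S \<Longrightarrow> c \<odot> x \<in> S"
    and sub_star: "x \<in> S \<Longrightarrow> star A x \<in> S"
begin

lemma sub_zero: "\<zero> \<in> S"
  using sub_smult[OF sub_one, of 0] by simp

lemma sub_in_carrier: "x \<in> S \<Longrightarrow> x \<in> carrier A"
  using sub_carrier by blast

lemma normed_star_algebra_sub: "normed_star_algebra (A\<lparr>carrier := S\<rparr>)"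
proof -
  have "star_algebra (A\<lparr>carrier := S\<rparr>)"
    by (rule star_algebraI)
      (auto simp: sub_in_carrier sub_zero sub_one sub_add sub_mult sub_smult sub_star
        a_ac m_assoc l_distr r_distr smult_add_left smult_add_right smult_smult
        smult_mult_left smult_mult_right star_add star_smult star_mult)
  then interpret S: star_algebra "A\<lparr>carrier := S\<rparr>" .
  show ?thesis
    by unfold_locales
      (auto simp: sub_in_carrier norm_eq_zero norm_triangle norm_smult norm_mult norm_one)
qed

sublocale sub: normed_star_algebra "A\<lparr>carrier := S\<rparr>"
  rewrites "cnorm (A\<lparr>carrier := S\<rparr>) = cnorm A"
  by (rule normed_star_algebra_sub) simp

lemma sub_minus: "\<lbrakk>x \<in> S; y \<in> S\<rbrakk> \<Longrightarrow> x \<ominus>\<^bsub>A\<lparr>carrier := S\<rparr>\<^esub> y = x \<ominus> y"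
  using sub.minus_eq_smult[of x y] by (simp add: minus_eq_smult sub_in_carrier)

lemma sub_tends_iff: "sub.tends X x \<longleftrightarrow> (\<forall>n. X n \<in> S) \<and> x \<in> S \<and> tends X x"
  unfolding sub.tends_def tends_def by (auto simp: sub_minus sub_in_carrier)

lemma mcomplete_sub:
  assumes complete: "metric.mcomplete" and closed: "\<And>X x. (\<And>n. X n \<in> S) \<Longrightarrow> tends X x \<Longrightarrow> x \<in> S"
  shows "sub.metric.mcomplete"
  unfolding sub.norm_complete_iff
proof (intro allI impI)
  fix X assume X: "sub.norm_Cauchy X"
  then have XS: "X n \<in> S" for n by (simp add: sub.norm_Cauchy_def)
  have "X m \<ominus>\<^bsub>A\<lparr>carrier := S\<rparr>\<^esub> X n = X m \<ominus> X n" for m n using XS by (simp add: sub_minus)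
  then have "norm_Cauchy X"
    using X by (simp add: sub.norm_Cauchy_def norm_Cauchy_def sub_in_carrier)
  then obtain x where "tends X x" using complete unfolding norm_complete_iff by blast
  then show "\<exists>x. sub.tends X x" using closed[of X x] XS by (auto simp: sub_tends_iff)
qed

lemma unital_star_subalgebra_closure: "unital_star_subalgebra A (norm_topology A closure_of S)"
proof -
  note cl = in_closure_iff[OF sub_carrier]
  have const: "S \<subseteq> norm_topology A closure_of S"
    unfolding subset_iff cl using tends_const sub_in_carrier by metis
  show ?thesis
  proof unfold_locales
    show "norm_topology A closure_of S \<subseteq> carrier A" using cl tendsD by blast
    show "\<one> \<in> norm_topology A closure_of S" using const sub_one by blast
  next
    fix x y assume "x \<in> norm_topology A closure_of S" "y \<in> norm_topology A closure_of S"
    then obtain X Y where "\<And>n. X n \<in> S" "tends X x" "\<And>n. Y n \<in> S" "tends Y y" using cl by metis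
    then show "x \<oplus> y \<in> norm_topology A closure_of S" "x \<otimes> y \<in> norm_topology A closure_of S"
      unfolding cl using sub_add sub_mult tends_add tends_mult by meson+
  next
    fix x assume "x \<in> norm_topology A closure_of S"
    then obtain X where "\<And>n. X n \<in> S" "tends X x" using cl by metis
    then show "c \<odot> x \<in> norm_topology A closure_of S" "star A x \<in> norm_topology A closure_of S" for c
      unfolding cl using sub_smult sub_star tends_smult tends_star by meson+
  qed
qed

lemma closure_sequentially_closed:
  assumes "\<And>n. X n \<in> norm_topology A closure_of S" "tends X x"
  shows "x \<in> norm_topology A closure_of S"
proof -
  have "closedin (norm_topology A) (norm_topology A closure_of S)" by simp
  then show ?thesis 
    unfolding norm_topology_eq metric.metric_closedin_iff_sequentially_closed
    using assms tends_iff_limitin tendsD(1) by (metis image_subset_iff norm_topology_eq)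
qed

end

locale normed_star_algebra_family =
  fixes D :: "'k set" and C :: "'k \<Rightarrow> ('a, 'm) cstar_struct_scheme"
  assumes nonempty: "D \<noteq> {}" and algebras: "a \<in> D \<Longrightarrow> normed_star_algebra (C a)"
begin

abbreviation P where "P \<equiv> bounded_prod D C"

lemma carrier_prod_iff:
  "F \<in> carrier P \<longleftrightarrow> F \<in> extensional D \<and> (\<forall>a\<in>D. F a \<in> carrier (C a)) \<and> 
    (\<exists>M. \<forall>a\<in>D. cnorm (C a) (F a) \<le> M)"
  by (auto simp: bounded_prod_def PiE_iff bdd_above_def)

lemma carrier_prodI:
  assumes "F \<in> extensional D" "\<And>a. a \<in> D \<Longrightarrow> F a \<in> carrier (C a)" 
    "\<And>a. a \<in> D \<Longrightarrow> cnorm (C a) (F a) \<le> M"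
  shows "F \<in> carrier P"
  using assms carrier_prod_iff by blast

lemma prod_component: "F \<in> carrier P \<Longrightarrow> a \<in> D \<Longrightarrow> F a \<in> carrier (C a)"
  by (simp add: carrier_prod_iff)

lemma prod_ext:
  assumes "F \<in> carrier P" "G \<in> carrier P" "\<And>a. a \<in> D \<Longrightarrow> F a = G a"
  shows "F = G"
  using assms by (auto simp: carrier_prod_iff intro: extensionalityI)

lemma prod_ops [simp]:
  "F \<oplus>\<^bsub>P\<^esub> G = (\<lambda>a\<in>D. F a \<oplus>\<^bsub>C a\<^esub> G a)" "F \<otimes>\<^bsub>P\<^esub> G = (\<lambda>a\<in>D. F a \<otimes>\<^bsub>C a\<^esub> G a)"
  "\<one>\<^bsub>P\<^esub> = (\<lambda>a\<in>D. \<one>\<^bsub>C a\<^esub>)" "\<zero>\<^bsub>P\<^esub> = (\<lambda>a\<in>D. \<zero>\<^bsub>C a\<^esub>)"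
  "c \<odot>\<^bsub>P\<^esub> F = (\<lambda>a\<in>D. c \<odot>\<^bsub>C a\<^esub> F a)" "star P F = (\<lambda>a\<in>D. star (C a) (F a))"
  by (simp_all add: bounded_prod_def)

lemma norm_component_le: "F \<in> carrier P \<Longrightarrow> a \<in> D \<Longrightarrow> cnorm (C a) (F a) \<le> cnorm P F"
  by (auto simp: bounded_prod_def intro: cSUP_upper)

lemma norm_prod_le: "(\<And>a. a \<in> D \<Longrightarrow> cnorm (C a) (F a) \<le> M) \<Longrightarrow> cnorm P F \<le> M"
  using nonempty by (auto simp: bounded_prod_def intro: cSUP_least)

lemma norm_prod_nonneg:
  assumes F: "F \<in> carrier P"
  shows "0 \<le> cnorm P F"
proof -
  obtain a where a: "a \<in> D" using nonempty by blast
  have "0 \<le> cnorm (C a) (F a)"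
    by (rule normed_star_algebra.norm_nonneg[OF algebras[OF a] prod_component[OF F a]])
  then show ?thesis using norm_component_le[OF F a] by simp
qed

lemma prod_closed:
  shows "\<zero>\<^bsub>P\<^esub> \<in> carrier P" "\<one>\<^bsub>P\<^esub> \<in> carrier P"
    and "\<lbrakk>F \<in> carrier P; G \<in> carrier P\<rbrakk> \<Longrightarrow> F \<oplus>\<^bsub>P\<^esub> G \<in> carrier P"
    and "\<lbrakk>F \<in> carrier P; G \<in> carrier P\<rbrakk> \<Longrightarrow> F \<otimes>\<^bsub>P\<^esub> G \<in> carrier P"
    and "F \<in> carrier P \<Longrightarrow> c \<odot>\<^bsub>P\<^esub> F \<in> carrier P"
    and "F \<in> carrier P \<Longrightarrow> star P F \<in> carrier P"
proof -
  note na = normed_star_algebra.norm_triangle[OF algebras] normed_star_algebra.norm_mult[OF algebras]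
    normed_star_algebra.norm_smult[OF algebras] normed_star_algebra.norm_star[OF algebras]
    normed_star_algebra.norm_one[OF algebras] normed_star_algebra.norm_zero[OF algebras]
    normed_star_algebra.norm_nonneg[OF algebras]
  have ring: "ring (C a)" and sa: "star_algebra (C a)" if "a \<in> D" for a
    using algebras[OF that] by (auto simp: normed_star_algebra_def star_algebra_def)
  note closed = ring.ring_simprules(1,2,5,6)[OF ring] star_algebra.smult_closed[OF sa]
    star_algebra.star_closed[OF sa]
  show "\<zero>\<^bsub>P\<^esub> \<in> carrier P" by (rule carrier_prodI[of _ 0]) (auto simp: na closed)
  show "\<one>\<^bsub>P\<^esub> \<in> carrier P" by (rule carrier_prodI[of _ 1]) (auto simp: na closed)
  show "F \<oplus>\<^bsub>P\<^esub> G \<in> carrier P" if "F \<in> carrier P" "G \<in> carrier P"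
    using that norm_component_le[OF that(1)] norm_component_le[OF that(2)]
    by (intro carrier_prodI[of _ "cnorm P F + cnorm P G"])
      (auto simp: closed prod_component intro!: order_trans[OF na(1)] add_mono)
  show "F \<otimes>\<^bsub>P\<^esub> G \<in> carrier P" if "F \<in> carrier P" "G \<in> carrier P"
    using that norm_component_le[OF that(1)] norm_component_le[OF that(2)]
    by (intro carrier_prodI[of _ "cnorm P F * cnorm P G"])
      (auto simp: closed prod_component na norm_prod_nonneg
        intro!: order_trans[OF na(2)] mult_mono)
  show "c \<odot>\<^bsub>P\<^esub> F \<in> carrier P" if "F \<in> carrier P"
    using that norm_component_le[OF that(1)]
    by (intro carrier_prodI[of _ "cmod c * cnorm P F"])
      (auto simp: closed prod_component na intro!: mult_left_mono)
  show "star P F \<in> carrier P" if "F \<in> carrier P"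
    using that norm_component_le[OF that(1)]
    by (intro carrier_prodI[of _ "cnorm P F"]) (auto simp: closed prod_component na)
qed

lemma normed_star_algebra_prod: "normed_star_algebra P"
proof -
  have ring: "ring (C a)" and sa: "star_algebra (C a)" if "a \<in> D" for a
    using algebras[OF that] by (auto simp: normed_star_algebra_def star_algebra_def)
  note ring_laws = ring.ring_simprules[OF ring] monoid.r_one[OF ring.is_monoid[OF ring]]
  note star_laws = star_algebra.smult_closed[OF sa] star_algebra.star_closed[OF sa]
    star_algebra.smult_add_left[OF sa] star_algebra.smult_add_right[OF sa]
    star_algebra.smult_smult[OF sa] star_algebra.smult_one[OF sa] star_algebra.smult_zero_left[OF sa]
    star_algebra.smult_mult_left[OF sa] star_algebra.smult_mult_right[OF sa]
    star_algebra.star_star[OF sa] star_algebra.star_add[OF sa]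
    star_algebra.star_smult[OF sa] star_algebra.star_mult[OF sa]
  note na = normed_star_algebra.norm_triangle[OF algebras] normed_star_algebra.norm_mult[OF algebras]
    normed_star_algebra.norm_smult[OF algebras] normed_star_algebra.norm_star[OF algebras]
    normed_star_algebra.norm_one[OF algebras] normed_star_algebra.norm_zero[OF algebras]
    normed_star_algebra.norm_nonneg[OF algebras]
  note mem = prod_component
  have "star_algebra P"
  proof (rule star_algebraI, goal_cases)
    \<comment> \<open>the laws with a bare family on one side need extensionality; in the others both sides are restrictions\<close>
    case (9 F) then show ?case
      by (intro prod_ext[OF prod_closed(3)[OF prod_closed(1)]]) (auto simp: mem ring_laws)
  next
    case (11 F) then show ?case
      by (intro prod_ext[OF prod_closed(4)[OF prod_closed(2)]]) (auto simp: mem ring_laws)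
  next
    case (12 F) then show ?case
      by (intro prod_ext[OF prod_closed(4)[OF _ prod_closed(2)]]) (auto simp: mem ring_laws)
  next
    case (18 F) then show ?case
      by (intro prod_ext[OF prod_closed(5)]) (auto simp: mem star_laws)
  next
    case (22 F) then show ?case
      by (intro prod_ext[OF prod_closed(6)[OF prod_closed(6)]]) (auto simp: mem star_laws)
  qed (fact prod_closed | simp add: mem ring_laws star_laws cong: restrict_cong; fail)+
  then interpret star_algebra P .
  have smult_le: "cnorm P (c \<odot>\<^bsub>P\<^esub> F) \<le> cmod c * cnorm P F" if "F \<in> carrier P" for c F
    by (rule norm_prod_le) (use that in \<open>auto simp: mem na intro!: mult_left_mono norm_component_le\<close>)
  show ?thesis
  proof unfold_locales
    fix F assume F: "F \<in> carrier P"
    show "0 \<le> cnorm P F" by (rule norm_prod_nonneg[OF F])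
    show "F = \<zero>\<^bsub>P\<^esub>" if "cnorm P F = 0"
    proof (rule prod_ext[OF F])
      show "\<zero>\<^bsub>P\<^esub> \<in> carrier P" by (rule prod_closed)
      fix a assume a: "a \<in> D"
      then have "cnorm (C a) (F a) = 0"
        using norm_component_le[OF F a] that na(7)[OF a mem[OF F a]] by simp
      then show "F a = \<zero>\<^bsub>P\<^esub> a"
        using normed_star_algebra.norm_eq_zero[OF algebras[OF a] mem[OF F a]] a by simp
    qed
    show "cnorm P (c \<odot>\<^bsub>P\<^esub> F) = cmod c * cnorm P F" for c
    proof (cases "c = 0")
      case True
      have "cnorm P \<zero>\<^bsub>P\<^esub> \<le> 0" by (rule norm_prod_le) (simp add: na)
      then show ?thesis using True smult_zero_left[OF F] norm_prod_nonneg[OF prod_closed(1)] by simp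
    next
      case False
      have "cmod c * cnorm P F = cmod c * cnorm P (inverse c \<odot>\<^bsub>P\<^esub> (c \<odot>\<^bsub>P\<^esub> F))"
        using False F by (simp only: smult_smult) (simp del: prod_ops add: smult_one)
      also have "\<dots> \<le> cmod c * (cmod (inverse c) * cnorm P (c \<odot>\<^bsub>P\<^esub> F))"
        using F by (intro mult_left_mono smult_le prod_closed) auto
      also have "\<dots> = cnorm P (c \<odot>\<^bsub>P\<^esub> F)" using False by (simp add: norm_inverse)
      finally show ?thesis using smult_le[OF F, of c] by simp
    qed
    show "cnorm P (star P F) = cnorm P F"
    proof (rule antisym)
      have le: "cnorm P (star P G) \<le> cnorm P G" if "G \<in> carrier P" for G
        by (rule norm_prod_le) (use that in \<open>auto simp: mem na intro!: norm_component_le\<close>)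
      show "cnorm P (star P F) \<le> cnorm P F" by (rule le[OF F])
      show "cnorm P F \<le> cnorm P (star P F)"
        using le[OF prod_closed(6)[OF F]] by (simp only: star_star[OF F])
    qed
  next
    fix F G assume F: "F \<in> carrier P" and G: "G \<in> carrier P"
    show "cnorm P (F \<oplus>\<^bsub>P\<^esub> G) \<le> cnorm P F + cnorm P G"
      by (rule norm_prod_le)
        (use F G in \<open>auto simp: mem intro!: order_trans[OF na(1)] add_mono norm_component_le\<close>)
    show "cnorm P (F \<otimes>\<^bsub>P\<^esub> G) \<le> cnorm P F * cnorm P G"
      by (rule norm_prod_le)
        (use F G in \<open>auto simp: mem na norm_prod_nonneg intro!: order_trans[OF na(2)] mult_mono norm_component_le\<close>)
  next
    show "cnorm P \<one>\<^bsub>P\<^esub> \<le> 1" by (rule norm_prod_le) (simp add: na)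
  qed
qed

sublocale prod: normed_star_algebra P by (rule normed_star_algebra_prod)

lemma prod_minus:
  assumes "F \<in> carrier P" "G \<in> carrier P" "a \<in> D"
  shows "(F \<ominus>\<^bsub>P\<^esub> G) a = F a \<ominus>\<^bsub>C a\<^esub> G a"
proof -
  interpret Ca: normed_star_algebra "C a" by (rule algebras[OF assms(3)])
  show ?thesis
    using assms by (simp add: prod.minus_eq_smult Ca.minus_eq_smult prod_component)
qed

text \<open>The coordinatewise limits form a bounded family, and the convergence is uniform in the coordinate,
because the Cauchy condition for the supremum norm is.\<close>

lemma mcomplete_prod:
  assumes complete: "\<And>a. a \<in> D \<Longrightarrow> Metric_space.mcomplete (carrier (C a)) (cdist (C a))"
  shows "prod.metric.mcomplete"
  unfolding prod.norm_complete_iff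
proof (intro allI impI)
  fix X assume X: "prod.norm_Cauchy X"
  then have Xc: "X n \<in> carrier P" for n by (simp add: prod.norm_Cauchy_def)
  have comp_le: "cnorm (C a) (X m a \<ominus>\<^bsub>C a\<^esub> X n a) \<le> cnorm P (X m \<ominus>\<^bsub>P\<^esub> X n)" if "a \<in> D" for a m n
    using norm_component_le[of "X m \<ominus>\<^bsub>P\<^esub> X n" a] that Xc by (simp add: prod_minus)
  have "\<exists>x. normed_star_algebra.tends (C a) (\<lambda>n. X n a) x" if a: "a \<in> D" for a
  proof -
    interpret Ca: normed_star_algebra "C a" by (rule algebras[OF a])
    have "Ca.norm_Cauchy (\<lambda>n. X n a)"
      unfolding Ca.norm_Cauchy_def
    proof (intro conjI allI impI)
      fix e :: real assume "e > 0"
      then obtain N where "\<forall>m\<ge>N. \<forall>n\<ge>N. cnorm P (X m \<ominus>\<^bsub>P\<^esub> X n) < e" 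
        using X unfolding prod.norm_Cauchy_def by blast
      then show "\<exists>N. \<forall>m\<ge>N. \<forall>n\<ge>N. cnorm (C a) (X m a \<ominus>\<^bsub>C a\<^esub> X n a) < e"
        using comp_le[OF a] by (meson le_less_trans)
    qed (use Xc a prod_component in auto)
    then show ?thesis using complete[OF a] Ca.norm_complete_iff by blast
  qed
  then obtain L where L: "\<And>a. a \<in> D \<Longrightarrow> normed_star_algebra.tends (C a) (\<lambda>n. X n a) (L a)" by metis
  define F where "F = restrict L D"
  have Fa: "F a \<in> carrier (C a)" if "a \<in> D" for a
    using normed_star_algebra.tendsD(2)[OF algebras L] that by (simp add: F_def)
  have unif: "\<exists>N. \<forall>n\<ge>N. \<forall>a\<in>D. cnorm (C a) (X n a \<ominus>\<^bsub>C a\<^esub> F a) \<le> e" if "e > 0" for e :: real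
  proof -
    obtain N where N: "\<And>m n. m \<ge> N \<Longrightarrow> n \<ge> N \<Longrightarrow> cnorm P (X m \<ominus>\<^bsub>P\<^esub> X n) < e" 
      using X \<open>e > 0\<close> unfolding prod.norm_Cauchy_def by meson
    have "cnorm (C a) (X n a \<ominus>\<^bsub>C a\<^esub> F a) \<le> e" if "n \<ge> N" "a \<in> D" for n a
    proof -
      interpret Ca: normed_star_algebra "C a" by (rule algebras[OF \<open>a \<in> D\<close>])
      note La = L[OF \<open>a \<in> D\<close>]
      have [simp]: "X m a \<in> carrier (C a)" for m using Xc \<open>a \<in> D\<close> prod_component by blast
      have "Ca.tends (\<lambda>m. X n a \<oplus>\<^bsub>C a\<^esub> (- 1) \<odot>\<^bsub>C a\<^esub> X m a) (X n a \<oplus>\<^bsub>C a\<^esub> (- 1) \<odot>\<^bsub>C a\<^esub> L a)"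
        by (intro Ca.tends_add Ca.tends_smult Ca.tends_const La) simp
      from Ca.tends_norm[OF this] 
      have "(\<lambda>m. cnorm (C a) (X n a \<ominus>\<^bsub>C a\<^esub> X m a)) \<longlonglongrightarrow> cnorm (C a) (X n a \<ominus>\<^bsub>C a\<^esub> L a)"
        using Ca.tendsD(2)[OF La] by (simp add: Ca.minus_eq_smult)
      then have "cnorm (C a) (X n a \<ominus>\<^bsub>C a\<^esub> L a) \<le> e"
      proof (rule LIMSEQ_le_const2)
        show "\<exists>N. \<forall>m\<ge>N. cnorm (C a) (X n a \<ominus>\<^bsub>C a\<^esub> X m a) \<le> e"
          using N[OF \<open>n \<ge> N\<close>] comp_le[OF \<open>a \<in> D\<close>] by (meson le_less_trans less_imp_le)
      qed
      then show ?thesis using \<open>a \<in> D\<close> by (simp add: F_def)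
    qed
    then show ?thesis by blast
  qed
  have F: "F \<in> carrier P"
  proof -
    obtain N where N: "\<And>a. a \<in> D \<Longrightarrow> cnorm (C a) (X N a \<ominus>\<^bsub>C a\<^esub> F a) \<le> 1" 
      using unif[of 1] by auto
    show ?thesis
    proof (rule carrier_prodI)
      fix a assume a: "a \<in> D"
      interpret Ca: normed_star_algebra "C a" by (rule algebras[OF a])
      have [simp]: "X N a \<in> carrier (C a)" using Xc a prod_component by blast
      show "cnorm (C a) (F a) \<le> 1 + cnorm P (X N)"
        using Ca.norm_le_norm_minus[of "F a" "X N a"] Ca.norm_minus_commute[of "F a" "X N a"] Fa[OF a] N[OF a]
          norm_component_le[OF Xc a, of N] by simp
    qed (use Fa in \<open>auto simp: F_def\<close>)
  qed
  have "(\<lambda>n. cnorm P (X n \<ominus>\<^bsub>P\<^esub> F)) \<longlonglongrightarrow> 0"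
  proof (rule LIMSEQ_I)
    fix e :: real assume "e > 0"
    then obtain N where N: "\<And>n a. n \<ge> N \<Longrightarrow> a \<in> D \<Longrightarrow> cnorm (C a) (X n a \<ominus>\<^bsub>C a\<^esub> F a) \<le> e / 2"
      using unif[of "e / 2"] by auto
    have "cnorm P (X n \<ominus>\<^bsub>P\<^esub> F) \<le> e / 2" if "n \<ge> N" for n
      by (rule norm_prod_le) (use N[OF that] Xc F in \<open>simp add: prod_minus\<close>)
    then show "\<exists>N. \<forall>n\<ge>N. norm (cnorm P (X n \<ominus>\<^bsub>P\<^esub> F) - 0) < e"
      using Xc F \<open>e > 0\<close> by (intro exI[of _ N]) (force simp del: prod_ops)
  qed
  then show "\<exists>x. prod.tends X x" using Xc F by (auto simp: prod.tends_def)
qed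

end

text \<open>Closedness is stated as stability under norm approximation, which is what makes the quotient
seminorm definite.\<close>

locale closed_star_ideal = normed_star_algebra P
  for P :: "('a, 'm) cstar_struct_scheme" (structure) +
  fixes J :: "'a set"
  assumes ideal_carrier: "J \<subseteq> carrier P"
    and ideal_zero: "\<zero> \<in> J"
    and ideal_add: "\<lbrakk>x \<in> J; y \<in> J\<rbrakk> \<Longrightarrow> x \<oplus> y \<in> J"
    and ideal_mult_left: "\<lbrakk>x \<in> carrier P; y \<in> J\<rbrakk> \<Longrightarrow> x \<otimes> y \<in> J"
    and ideal_mult_right: "\<lbrakk>x \<in> J; y \<in> carrier P\<rbrakk> \<Longrightarrow> x \<otimes> y \<in> J"
    and ideal_star: "x \<in> J \<Longrightarrow> star P x \<in> J"
    and ideal_closed: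
      "\<lbrakk>x \<in> carrier P; \<And>e. e > 0 \<Longrightarrow> \<exists>y\<in>J. cnorm P (x \<ominus> y) < e\<rbrakk> \<Longrightarrow> x \<in> J"
begin

lemma ideal_in_carrier: "x \<in> J \<Longrightarrow> x \<in> carrier P"
  using ideal_carrier by blast

lemma ideal_smult:
  assumes "x \<in> J"
  shows "c \<odot> x \<in> J"
  using ideal_mult_left[of "c \<odot> \<one>" x] assms by (simp add: smult_mult_left ideal_in_carrier)

lemma ideal_uminus: "x \<in> J \<Longrightarrow> \<ominus> x \<in> J"
  using ideal_smult[of x "-1"] by (simp add: minus_one_smult ideal_in_carrier)

lemma ideal_J: "ideal J P"
proof (rule idealI)
  show "ring P" ..
  show "subgroup J (add_monoid P)"
    by (rule add.subgroupI)
      (use ideal_zero in \<open>auto simp: ideal_in_carrier ideal_add ideal_uminus simp flip: a_inv_def\<close>)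
qed (simp_all add: ideal_mult_left ideal_mult_right)

sublocale ideal J P by (rule ideal_J)

abbreviation Q where "Q \<equiv> quotient_cstar P J"
abbreviation coset where "coset x \<equiv> J +> x"

lemma mem_coset_iff: "x \<in> carrier P \<Longrightarrow> y \<in> coset x \<longleftrightarrow> y \<in> carrier P \<and> y \<ominus> x \<in> J"
  using a_elemrcos_carrier[of x y] a_rcos_module_minus[OF ring_axioms, of x y] by blast

lemma coset_self: "x \<in> carrier P \<Longrightarrow> x \<in> coset x"
  by (simp add: mem_coset_iff ideal_zero)

lemma coset_eq_iff: 
  assumes "x \<in> carrier P" "y \<in> carrier P"
  shows "coset x = coset y \<longleftrightarrow> x \<ominus> y \<in> J"
proof
  assume "coset x = coset y"
  then show "x \<ominus> y \<in> J" using coset_self[OF assms(1)] assms by (simp add: mem_coset_iff)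
next
  assume "x \<ominus> y \<in> J"
  then have "x \<in> coset y" using assms by (simp add: mem_coset_iff)
  then show "coset x = coset y" by (rule a_repr_independence'[OF _ assms(2), symmetric])
qed

lemma quotient_ops:
  "carrier Q = coset ` carrier P" "\<zero>\<^bsub>Q\<^esub> = coset \<zero>" "\<one>\<^bsub>Q\<^esub> = coset \<one>"
  "\<lbrakk>x \<in> carrier P; y \<in> carrier P\<rbrakk> \<Longrightarrow> coset x \<oplus>\<^bsub>Q\<^esub> coset y = coset (x \<oplus> y)"
  "\<lbrakk>x \<in> carrier P; y \<in> carrier P\<rbrakk> \<Longrightarrow> coset x \<otimes>\<^bsub>Q\<^esub> coset y = coset (x \<otimes> y)"
proof -
  show "carrier Q = coset ` carrier P"
    by (simp add: quotient_cstar_def FactRing_simps UNION_singleton_eq_range)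
  show "\<zero>\<^bsub>Q\<^esub> = coset \<zero>" "\<one>\<^bsub>Q\<^esub> = coset \<one>"
    using a_rcos_const[OF ideal_zero] by (simp_all add: quotient_cstar_def FactRing_simps)
  show "\<lbrakk>x \<in> carrier P; y \<in> carrier P\<rbrakk> \<Longrightarrow> coset x \<oplus>\<^bsub>Q\<^esub> coset y = coset (x \<oplus> y)"
    by (simp add: quotient_cstar_def FactRing_def a_rcos_sum)
  show "\<lbrakk>x \<in> carrier P; y \<in> carrier P\<rbrakk> \<Longrightarrow> coset x \<otimes>\<^bsub>Q\<^esub> coset y = coset (x \<otimes> y)"
    by (simp add: quotient_cstar_def FactRing_def rcoset_mult_add)
qed

lemma coset_zero: "coset \<zero> = J"
  by (rule a_rcos_const[OF ideal_zero])

lemma quotient_smult: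
  assumes x: "x \<in> carrier P"
  shows "c \<odot>\<^bsub>Q\<^esub> coset x = coset (c \<odot> x)"
proof -
  have rep: "coset (c \<odot> y) = coset (c \<odot> x)" if "y \<in> coset x" for y
    using that x by (subst coset_eq_iff) (auto simp: mem_coset_iff ideal_smult simp flip: smult_minus)
  have "c \<odot>\<^bsub>Q\<^esub> coset x = (\<Union>y\<in>coset x. coset (c \<odot> y))" by (simp add: quotient_cstar_def)
  also have "\<dots> = (\<Union>y\<in>coset x. coset (c \<odot> x))" by (intro SUP_cong refl rep)
  also have "\<dots> = coset (c \<odot> x)" using coset_self[OF x] by (subst UN_constant) auto
  finally show ?thesis .
qed

lemma quotient_star:
  assumes x: "x \<in> carrier P"
  shows "star Q (coset x) = coset (star P x)"
proof -
  have rep: "coset (star P y) = coset (star P x)" if "y \<in> coset x" for y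
    using that x by (subst coset_eq_iff) (auto simp: mem_coset_iff ideal_star simp flip: star_minus)
  have "star Q (coset x) = (\<Union>y\<in>coset x. coset (star P y))" by (simp add: quotient_cstar_def)
  also have "\<dots> = (\<Union>y\<in>coset x. coset (star P x))" by (intro SUP_cong refl rep)
  also have "\<dots> = coset (star P x)" using coset_self[OF x] by (subst UN_constant) auto
  finally show ?thesis .
qed

lemma quotient_norm_le:
  assumes "x \<in> carrier P" "y \<in> coset x"
  shows "cnorm Q (coset x) \<le> cnorm P y"
proof -
  have "cnorm Q (coset x) = (INF y\<in>coset x. cnorm P y)" by (simp add: quotient_cstar_def)
  also have "\<dots> \<le> cnorm P y"
    using assms by (intro cINF_lower bdd_belowI2[of _ 0]) (simp_all add: mem_coset_iff)
  finally show ?thesis .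
qed

lemma quotient_norm_less:
  assumes "x \<in> carrier P" "cnorm Q (coset x) < r"
  obtains y where "y \<in> carrier P" "coset y = coset x" "cnorm P y < r"
proof -
  have "cnorm Q (coset x) = (INF y\<in>coset x. cnorm P y)" by (simp add: quotient_cstar_def)
  moreover have "bdd_below (cnorm P ` coset x)"
    using assms(1) by (intro bdd_belowI2[of _ 0]) (simp add: mem_coset_iff)
  moreover have "coset x \<noteq> {}" using coset_self[OF assms(1)] by blast
  ultimately have "\<exists>y\<in>coset x. cnorm P y < r"
    using assms(2) by (simp add: cINF_less_iff)
  then obtain y where "y \<in> coset x" "cnorm P y < r" by blast
  then show ?thesis
    using that[of y] assms(1) by (simp add: mem_coset_iff coset_eq_iff)
qed

lemma quotient_norm_le_rep: "x \<in> carrier P \<Longrightarrow> cnorm Q (coset x) \<le> cnorm P x"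
  by (simp add: quotient_norm_le coset_self)

lemma quotient_norm_leI:
  assumes x: "x \<in> carrier P"
    and le: "\<And>y. \<lbrakk>y \<in> carrier P; coset y = coset x\<rbrakk> \<Longrightarrow> r \<le> cnorm P y"
  shows "r \<le> cnorm Q (coset x)"
proof (rule ccontr)
  assume "\<not> r \<le> cnorm Q (coset x)"
  then obtain y where "y \<in> carrier P" "coset y = coset x" "cnorm P y < r"
    using quotient_norm_less[OF x, of r] by (metis not_le)
  then show False using le[of y] by simp
qed

lemma coset_in_quotient [simp]: "x \<in> carrier P \<Longrightarrow> coset x \<in> carrier Q"
  by (simp add: quotient_ops(1))

lemma quotientE:
  assumes "X \<in> carrier Q"
  obtains x where "x \<in> carrier P" "X = coset x"
  using assms by (auto simp: quotient_ops(1))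

lemma star_algebra_quotient: "star_algebra Q"
proof -
  have ops: "coset x \<oplus>\<^bsub>Q\<^esub> coset y = coset (x \<oplus> y)" "coset x \<otimes>\<^bsub>Q\<^esub> coset y = coset (x \<otimes> y)"
    "c \<odot>\<^bsub>Q\<^esub> coset x = coset (c \<odot> x)" "star Q (coset x) = coset (star P x)"
    if "x \<in> carrier P" "y \<in> carrier P" for x y c
    using that by (simp_all add: quotient_ops quotient_smult quotient_star)
  show ?thesis
    by (rule star_algebraI; (elim quotientE)?)
      (simp_all add: quotient_ops(2,3) ops quotient_smult quotient_star
        a_ac m_assoc l_distr r_distr smult_add_left smult_add_right smult_smult
        smult_mult_left smult_mult_right star_add star_smult star_mult)
qed

sublocale quot: star_algebra Q by (rule star_algebra_quotient)

lemma quotient_minus: 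
  "\<lbrakk>x \<in> carrier P; y \<in> carrier P\<rbrakk> \<Longrightarrow> coset x \<ominus>\<^bsub>Q\<^esub> coset y = coset (x \<ominus> y)"
  by (simp add: quot.minus_eq_smult minus_eq_smult quotient_smult quotient_ops)

lemma normed_star_algebra_quotient: "normed_star_algebra Q"
proof -
  have nonneg: "0 \<le> cnorm Q (coset x)" if "x \<in> carrier P" for x
    by (rule quotient_norm_leI[OF that]) simp
  have le_of_epsilon: "cnorm Q X \<le> r" if "\<And>e. e > 0 \<Longrightarrow> cnorm Q X \<le> r + e" for X r
    using that by (rule field_le_epsilon)
  have smult_le: "cnorm Q (coset (c \<odot> x)) \<le> cmod c * cnorm Q (coset x)" if x: "x \<in> carrier P" and "c \<noteq> 0" for c x
  proof -
    have "cnorm Q (coset (c \<odot> x)) / cmod c \<le> cnorm Q (coset x)"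
    proof (rule quotient_norm_leI[OF x])
      fix y assume y: "y \<in> carrier P" "coset y = coset x"
      then have "coset (c \<odot> y) = coset (c \<odot> x)" using x by (metis quotient_smult)
      then show "cnorm Q (coset (c \<odot> x)) / cmod c \<le> cnorm P y"
        using quotient_norm_le_rep[of "c \<odot> y"] y \<open>c \<noteq> 0\<close>
        by (simp add: norm_smult field_simps)
    qed
    then show ?thesis using \<open>c \<noteq> 0\<close> by (simp add: field_simps)
  qed
  show ?thesis
  proof unfold_locales
    fix X assume "X \<in> carrier Q"
    then obtain x where x: "x \<in> carrier P" and X: "X = coset x" by (rule quotientE)
    show "0 \<le> cnorm Q X" using nonneg x X by simp
    show "X = \<zero>\<^bsub>Q\<^esub>" if "cnorm Q X = 0"
    proof -
      have "x \<in> J"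
      proof (rule ideal_closed[OF x])
        fix e :: real assume "e > 0"
        then have "cnorm Q (coset x) < e" using that X by simp
        then obtain y where y: "y \<in> carrier P" "coset y = coset x" "cnorm P y < e"
          by (rule quotient_norm_less[OF x])
        have "x \<ominus> (x \<ominus> y) = y" using x y by (simp add: minus_eq minus_add r_neg2 minus_minus)
        moreover have "x \<ominus> y \<in> J" using x y by (metis coset_eq_iff)
        ultimately show "\<exists>z\<in>J. cnorm P (x \<ominus> z) < e"
          using y(3) by (intro bexI[of _ "x \<ominus> y"]) simp_all
      qed
      then show ?thesis by (simp add: X quotient_ops(2) coset_zero a_rcos_const)
    qed
    show "cnorm Q (c \<odot>\<^bsub>Q\<^esub> X) = cmod c * cnorm Q X" for c
    proof (cases "c = 0")
      case True
      have "cnorm Q (coset \<zero>) = 0"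
        using quotient_norm_le_rep[of \<zero>] nonneg[of \<zero>] by simp
      then show ?thesis using True x by (simp add: X quotient_smult)
    next
      case False
      have "cnorm Q (coset x) \<le> cmod (inverse c) * cnorm Q (coset (c \<odot> x))"
        using smult_le[of "c \<odot> x" "inverse c"] x False by (simp add: smult_smult)
      then have "cmod c * cnorm Q (coset x) \<le> cnorm Q (coset (c \<odot> x))"
        using False by (simp add: norm_divide norm_inverse field_simps)
      then show ?thesis using smult_le[OF x False] x by (simp add: X quotient_smult)
    qed
    show "cnorm Q (star Q X) = cnorm Q X"
    proof -
      have le: "cnorm Q (coset (star P y)) \<le> cnorm Q (coset y)" if y: "y \<in> carrier P" for y
      proof (rule quotient_norm_leI[OF y])
        fix z assume z: "z \<in> carrier P" "coset z = coset y"
        then have "coset (star P z) = coset (star P y)" using y by (metis quotient_star)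
        then show "cnorm Q (coset (star P y)) \<le> cnorm P z"
          using quotient_norm_le_rep[of "star P z"] z by simp
      qed
      show ?thesis using le[OF x] le[of "star P x"] x by (simp add: X quotient_star)
    qed
  next
    fix X Y assume XY: "X \<in> carrier Q" "Y \<in> carrier Q"
    then obtain x y where x: "x \<in> carrier P" and X: "X = coset x" 
      and y: "y \<in> carrier P" and Y: "Y = coset y" by (meson quotientE)
    have rep: "\<exists>u v. u \<in> carrier P \<and> v \<in> carrier P \<and> X = coset u \<and> Y = coset v 
        \<and> cnorm P u < cnorm Q X + e \<and> cnorm P v < cnorm Q Y + e" if "e > 0" for e
      using quotient_norm_less[OF x, of "cnorm Q X + e"] quotient_norm_less[OF y, of "cnorm Q Y + e"] that X Y
      by (metis less_add_same_cancel1)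
    show "cnorm Q (X \<oplus>\<^bsub>Q\<^esub> Y) \<le> cnorm Q X + cnorm Q Y"
    proof (rule le_of_epsilon)
      fix e :: real assume "e > 0"
      then obtain u v where uv: "u \<in> carrier P" "v \<in> carrier P" "X = coset u" "Y = coset v"
        "cnorm P u < cnorm Q X + e / 2" "cnorm P v < cnorm Q Y + e / 2" using rep[of "e / 2"] by auto
      have "cnorm Q (X \<oplus>\<^bsub>Q\<^esub> Y) \<le> cnorm P (u \<oplus> v)"
        using uv quotient_norm_le_rep[of "u \<oplus> v"] by (simp add: quotient_ops)
      then show "cnorm Q (X \<oplus>\<^bsub>Q\<^esub> Y) \<le> cnorm Q X + cnorm Q Y + e"
        using norm_triangle[OF uv(1,2)] uv(5,6) by linarith
    qed
    \<comment> \<open>representatives come within any \<open>e > 0\<close> of the quotient norms; let \<open>e\<close> tend to \<open>0\<close>\<close>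
    have "((\<lambda>e. (cnorm Q X + e) * (cnorm Q Y + e)) \<longlongrightarrow> (cnorm Q X + 0) * (cnorm Q Y + 0)) (at_right 0)"
      by (intro tendsto_intros)
    moreover have "\<forall>\<^sub>F e in at_right 0. cnorm Q (X \<otimes>\<^bsub>Q\<^esub> Y) \<le> (cnorm Q X + e) * (cnorm Q Y + e)"
      using eventually_at_right_less
    proof eventually_elim
      case (elim e)
      then obtain u v where uv: "u \<in> carrier P" "v \<in> carrier P" "X = coset u" "Y = coset v"
        "cnorm P u < cnorm Q X + e" "cnorm P v < cnorm Q Y + e" using rep[of e] by auto
      have "cnorm Q (X \<otimes>\<^bsub>Q\<^esub> Y) \<le> cnorm P (u \<otimes> v)"
        using uv(1-4) quotient_norm_le_rep[of "u \<otimes> v"] by (simp add: quotient_ops)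
      also have "\<dots> \<le> cnorm P u * cnorm P v" by (rule norm_mult[OF uv(1,2)])
      also have "\<dots> \<le> (cnorm Q X + e) * (cnorm Q Y + e)"
        using uv norm_nonneg[OF uv(1)] norm_nonneg[OF uv(2)] by (intro mult_mono) linarith+
      finally show ?case .
    qed
    ultimately show "cnorm Q (X \<otimes>\<^bsub>Q\<^esub> Y) \<le> cnorm Q X * cnorm Q Y"
      using tendsto_lowerbound[OF _ _ trivial_limit_at_right_real] by simp
  next
    show "cnorm Q \<one>\<^bsub>Q\<^esub> \<le> 1"
      using quotient_norm_le_rep[OF one_closed] norm_one by (simp add: quotient_ops)
  qed
qed

sublocale quot: normed_star_algebra Q by (rule normed_star_algebra_quotient)

text \<open>Representatives of a sequence of cosets with steps below \<open>(1/2) ^ n\<close> can be chosen one after the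
other with the same bound on their steps, since each difference of cosets has a representative
that small. They converge, and the coset map is contractive.\<close>

lemma mcomplete_quotient:
  assumes complete: "metric.mcomplete"
  shows "quot.metric.mcomplete"
proof (rule quot.mcompleteI_geometric)
  fix X assume X: "\<And>n. X n \<in> carrier Q" and step: "\<And>n. cnorm Q (X (Suc n) \<ominus>\<^bsub>Q\<^esub> X n) < (1/2) ^ n"
  have "\<exists>x. \<forall>n. (x n \<in> carrier P \<and> X n = coset (x n)) \<and> cnorm P (x (Suc n) \<ominus> x n) < (1/2) ^ n"
  proof (rule dependent_nat_choice)
    show "\<exists>x. x \<in> carrier P \<and> X 0 = coset x" using X[of 0] by (meson quotientE)
    fix x n assume x: "x \<in> carrier P \<and> X n = coset x"
    obtain y where y: "y \<in> carrier P" "X (Suc n) = coset y" using X[of "Suc n"] by (meson quotientE)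
    have "cnorm Q (coset (y \<ominus> x)) < (1/2) ^ n" using step[of n] x y by (simp add: quotient_minus)
    then obtain d where d: "d \<in> carrier P" "coset d = coset (y \<ominus> x)" "cnorm P d < (1/2) ^ n"
      using quotient_norm_less[of "y \<ominus> x"] x y by (metis minus_closed)
    have "coset (d \<oplus> x) = coset (y \<ominus> x \<oplus> x)"
      using d x y by (metis quotient_ops(4) minus_closed)
    also have "y \<ominus> x \<oplus> x = y" using x y by (simp add: minus_eq a_assoc l_neg)
    finally have "X (Suc n) = coset (d \<oplus> x)" using y by simp
    moreover have "(d \<oplus> x) \<ominus> x = d" using d x by (simp add: minus_eq a_assoc r_neg)
    ultimately show "\<exists>z. (z \<in> carrier P \<and> X (Suc n) = coset z) \<and> cnorm P (z \<ominus> x) < (1/2) ^ n"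
      using d x by (intro exI[of _ "d \<oplus> x"]) simp
  qed
  then obtain x where x: "\<And>n. x n \<in> carrier P" "\<And>n. X n = coset (x n)" 
    and xs: "\<And>n. cnorm P (x (Suc n) \<ominus> x n) < (1/2) ^ n" by blast
  have "norm_Cauchy x"
    by (rule norm_Cauchy_geometric[of _ "1/2" 1]) (use x xs in \<open>auto intro: less_imp_le\<close>)
  then obtain l where l: "tends x l" using complete norm_complete_iff by blast
  have "quot.tends X (coset l)"
  proof (rule quot.tendsI[OF X _ tendsD(3)[OF l]])
    show "cnorm Q (X n \<ominus>\<^bsub>Q\<^esub> coset l) \<le> cnorm P (x n \<ominus> l)" for n
      using x tendsD(2)[OF l] quotient_norm_le_rep[of "x n \<ominus> l"] by (simp add: quotient_minus)
  qed (use tendsD(2)[OF l] in simp)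
  then show "\<exists>l. quot.tends X l" by blast
qed

end

text \<open>The map between quotients induced by a map on representatives. Like the operations of
\<open>quotient_cstar\<close>, it is a union over representatives, which is a single coset as soon as the ideal
of the source is mapped into that of the target.\<close>

definition quotient_lift ::
  "('b, 'n) cstar_struct_scheme \<Rightarrow> 'b set \<Rightarrow> ('a \<Rightarrow> 'b) \<Rightarrow> 'a set \<Rightarrow> 'b set" where
  "quotient_lift P' J' \<Phi> X = (\<Union>x\<in>X. J' +>\<^bsub>P'\<^esub> \<Phi> x)"

locale contractive_ideal_hom =
  source: closed_star_ideal P J + target: closed_star_ideal P' J'
  for P :: "('a, 'm) cstar_struct_scheme" and J 
    and P' :: "('b, 'n) cstar_struct_scheme" and J' +
  fixes \<Phi> :: "'a \<Rightarrow> 'b"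
  assumes hom: "\<Phi> \<in> star_hom P P'"
    and contractive: "x \<in> carrier P \<Longrightarrow> cnorm P' (\<Phi> x) \<le> cnorm P x"
    and ideal_image: "x \<in> J \<Longrightarrow> \<Phi> x \<in> J'"
begin

lemma quotient_lift_coset:
  assumes x: "x \<in> carrier P"
  shows "quotient_lift P' J' \<Phi> (source.coset x) = target.coset (\<Phi> x)"
proof -
  have "target.coset (\<Phi> y) = target.coset (\<Phi> x)" if y: "y \<in> source.coset x" for y
  proof (subst target.coset_eq_iff)
    have "\<Phi> (y \<ominus>\<^bsub>P\<^esub> x) \<in> J'" using y x by (simp add: source.mem_coset_iff ideal_image)
    then show "\<Phi> y \<ominus>\<^bsub>P'\<^esub> \<Phi> x \<in> J'"
      using y x star_hom_minus[OF source.star_algebra_axioms target.star_algebra_axioms hom]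
      by (simp add: source.mem_coset_iff)
  qed (use y x star_homD(1)[OF hom] in \<open>auto simp: source.mem_coset_iff\<close>)
  then have "quotient_lift P' J' \<Phi> (source.coset x) = (\<Union>y\<in>source.coset x. target.coset (\<Phi> x))"
    unfolding quotient_lift_def by (rule SUP_cong[OF refl])
  also have "\<dots> = target.coset (\<Phi> x)" using source.coset_self[OF x] by (subst UN_constant) auto
  finally show ?thesis .
qed

lemma quotient_lift_star_hom: "quotient_lift P' J' \<Phi> \<in> star_hom source.Q target.Q"
  unfolding star_hom_def
  by (intro CollectI conjI ballI allI funcsetI; elim source.quotientE)
    (simp_all add: quotient_lift_coset star_homD[OF hom] source.quotient_ops(4,5) target.quotient_ops(4,5)
      source.quotient_smult target.quotient_smult source.quotient_star target.quotient_star)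

lemma quotient_lift_contractive:
  assumes "X \<in> carrier source.Q"
  shows "cnorm target.Q (quotient_lift P' J' \<Phi> X) \<le> cnorm source.Q X"
proof -
  obtain x where x: "x \<in> carrier P" and X: "X = source.coset x" using assms by (rule source.quotientE)
  show ?thesis unfolding X
  proof (rule source.quotient_norm_leI[OF x])
    fix y assume y: "y \<in> carrier P" "source.coset y = source.coset x"
    then show "cnorm target.Q (quotient_lift P' J' \<Phi> (source.coset x)) \<le> cnorm P y"
      using target.quotient_norm_le_rep[of "\<Phi> y"] contractive[of y] star_homD(1)[OF hom, of y]
      by (simp add: y(2)[symmetric] quotient_lift_coset)
  qed
qed

end

section \<open>Isometric images and inductive limits\<close>

lemma contractive_star_hom_tends:
  assumes A: "normed_star_algebra A" and B: "normed_star_algebra B" and h: "h \<in> star_hom A B"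
    and contractive: "\<And>x. x \<in> carrier A \<Longrightarrow> cnorm B (h x) \<le> cnorm A x"
    and X: "normed_star_algebra.tends A X x"
  shows "normed_star_algebra.tends B (\<lambda>n. h (X n)) (h x)"
proof -
  interpret A: normed_star_algebra A by fact
  interpret B: normed_star_algebra B by fact
  note X' = A.tendsD[OF X]
  show ?thesis
  proof (rule B.tendsI[OF _ _ X'(3)])
    show "cnorm B (h (X n) \<ominus>\<^bsub>B\<^esub> h x) \<le> cnorm A (X n \<ominus>\<^bsub>A\<^esub> x)" for n
      using contractive[of "X n \<ominus>\<^bsub>A\<^esub> x"] X'
        star_hom_minus[OF A.star_algebra_axioms B.star_algebra_axioms h X'(1)[of n] X'(2)] by simp
  qed (use star_homD(1)[OF h] X' in auto)
qed

text \<open>Only closedness of the image needs an argument: if \<open>h x\<^sub>n\<close> converges, then \<open>x\<^sub>n\<close> is Cauchy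
because \<open>h\<close> preserves distances, so it converges in \<open>A\<close>, and \<open>h\<close> maps its limit to that of
\<open>h x\<^sub>n\<close>.\<close>

lemma isometric_star_hom_image:
  assumes A: "normed_star_algebra A" and B: "normed_star_algebra B" and h: "h \<in> star_hom A B"
    and isometric: "\<And>x. x \<in> carrier A \<Longrightarrow> cnorm B (h x) = cnorm A x"
    and complete: "Metric_space.mcomplete (carrier A) (cdist A)"
  shows "cstar_subalgebra (h ` carrier A) B"
    and "star_isomorphic A (B\<lparr>carrier := h ` carrier A\<rparr>)"
proof -
  interpret A: normed_star_algebra A by fact
  interpret B: normed_star_algebra B by fact
  note hs = star_homD[OF h]
  have minus: "h (x \<ominus>\<^bsub>A\<^esub> y) = h x \<ominus>\<^bsub>B\<^esub> h y" if "x \<in> carrier A" "y \<in> carrier A" for x y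
    by (rule star_hom_minus[OF A.star_algebra_axioms B.star_algebra_axioms h that])
  have dist: "cnorm A (x \<ominus>\<^bsub>A\<^esub> y) = cnorm B (h x \<ominus>\<^bsub>B\<^esub> h y)" if "x \<in> carrier A" "y \<in> carrier A" for x y
    using that isometric[of "x \<ominus>\<^bsub>A\<^esub> y"] by (simp add: minus)
  have "inj_on h (carrier A)"
  proof (rule inj_onI)
    fix x y assume xy: "x \<in> carrier A" "y \<in> carrier A" "h x = h y"
    then have "cnorm A (x \<ominus>\<^bsub>A\<^esub> y) = 0" by (simp add: dist hs)
    then have "x \<ominus>\<^bsub>A\<^esub> y = \<zero>\<^bsub>A\<^esub>" using xy by (intro A.norm_eq_zero) simp_all
    then show "x = y" using xy by (simp add: A.minus_eq_zero_iff)
  qed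
  then show "star_isomorphic A (B\<lparr>carrier := h ` carrier A\<rparr>)"
    unfolding star_isomorphic_def using hs by (intro bexI[of _ h]) (auto simp: star_hom_def bij_betw_def)
  have "closedin (norm_topology B) (h ` carrier A)"
  proof (rule B.closedin_norm_topologyI)
    show "h ` carrier A \<subseteq> carrier B" using hs by auto
    fix Y y assume "\<And>n. Y n \<in> h ` carrier A" and Y: "B.tends Y y"
    then have "\<forall>n. \<exists>x. x \<in> carrier A \<and> Y n = h x" by blast
    then obtain X where X: "\<And>n. X n \<in> carrier A" "\<And>n. Y n = h (X n)" by metis
    have "limitin B.metric.mtopology Y y sequentially"
      using Y B.tends_iff_limitin B.tendsD(1) by blast
    then have "B.norm_Cauchy Y"
      unfolding B.norm_Cauchy_iff_MCauchy
      by (rule B.metric.convergent_imp_MCauchy[rotated]) (use B.tendsD(1)[OF Y] in auto)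
    then have "A.norm_Cauchy X"
      by (simp add: A.norm_Cauchy_def B.norm_Cauchy_def X dist)
    then obtain x where x: "A.tends X x" using complete unfolding A.norm_complete_iff by blast
    have "B.tends (\<lambda>n. h (X n)) (h x)"
      by (rule contractive_star_hom_tends[OF A B h _ x]) (simp add: isometric)
    moreover have "Y = (\<lambda>n. h (X n))" using X(2) by (rule ext)
    ultimately have "B.tends Y (h x)" by simp
    then show "y \<in> h ` carrier A" using B.tends_unique[OF Y] A.tendsD(2)[OF x] by blast
  qed
  moreover have "\<zero>\<^bsub>B\<^esub> \<in> h ` carrier A"
    using star_hom_zero[OF A.star_algebra_axioms B.star_algebra_axioms h]
    by (intro image_eqI[of _ _ "\<zero>\<^bsub>A\<^esub>"]) simp_all
  moreover have "h x \<oplus>\<^bsub>B\<^esub> h y \<in> h ` carrier A" "h x \<otimes>\<^bsub>B\<^esub> h y \<in> h ` carrier A"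
    "c \<odot>\<^bsub>B\<^esub> h x \<in> h ` carrier A" "star B (h x) \<in> h ` carrier A"
    if "x \<in> carrier A" "y \<in> carrier A" for x y c
    using that by (simp_all only: hs(2-5)[symmetric] A.a_closed A.m_closed A.smult_closed A.star_closed imageI)
  moreover have "h ` carrier A \<subseteq> carrier B" using hs(1) by (rule image_subsetI)
  ultimately show "cstar_subalgebra (h ` carrier A) B"
    unfolding cstar_subalgebra_def by simp
qed

lemma eventually_tail_filter:
  assumes "upward_directed D"
  shows "eventually P (tail_filter D) \<longleftrightarrow> (\<exists>a\<in>D. \<forall>b\<in>D. a \<le> b \<longrightarrow> P b)"
proof -
  have "\<exists>c\<in>D. principal {x\<in>D. c \<le> x} \<le> inf (principal {x\<in>D. a \<le> x}) (principal {x\<in>D. b \<le> x})"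
    if ab: "a \<in> D" "b \<in> D" for a b
  proof -
    obtain c where "c \<in> D" "a \<le> c" "b \<le> c"
      using assms ab unfolding upward_directed_def by meson
    then show ?thesis by (intro bexI[of _ c]) auto
  qed
  then show ?thesis
    unfolding tail_filter_def using assms
    by (subst eventually_INF_base) (auto simp: upward_directed_def eventually_principal)
qed

text \<open>Inductive systems over one directed set, in a generality that covers both the given C*-algebras
and the products of limit algebras. Contractivity is automatic for the former; for the latter it
is immediate, since the connecting maps restrict families to fewer indices.\<close>

locale normed_star_system = normed_star_algebra_family D C
  for D :: "'k::order set" and C :: "'k \<Rightarrow> ('a, 'm) cstar_struct_scheme" +
  fixes \<rho> :: "'k \<Rightarrow> 'k \<Rightarrow> 'a \<Rightarrow> 'a"
  assumes directed: "upward_directed D"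
    and connecting: "\<lbrakk>a \<in> D; b \<in> D; a \<le> b\<rbrakk> \<Longrightarrow> \<rho> b a \<in> unital_star_hom (C a) (C b)"
    and connecting_contractive:
      "\<lbrakk>a \<in> D; b \<in> D; a \<le> b; x \<in> carrier (C a)\<rbrakk> \<Longrightarrow> cnorm (C b) (\<rho> b a x) \<le> cnorm (C a) x"
    and connecting_comp:
      "\<lbrakk>a \<in> D; b \<in> D; c \<in> D; a \<le> b; b \<le> c; x \<in> carrier (C a)\<rbrakk> \<Longrightarrow> \<rho> c a x = \<rho> c b (\<rho> b a x)"
begin

lemma upper_bound:
  assumes "a \<in> D" "b \<in> D"
  obtains c where "c \<in> D" "a \<le> c" "b \<le> c"
  using directed assms unfolding upward_directed_def by meson

lemma connecting_hom: "\<lbrakk>a \<in> D; b \<in> D; a \<le> b\<rbrakk> \<Longrightarrow> \<rho> b a \<in> star_hom (C a) (C b)"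
  using connecting by (auto simp: unital_star_hom_def)

lemma connecting_one: "\<lbrakk>a \<in> D; b \<in> D; a \<le> b\<rbrakk> \<Longrightarrow> \<rho> b a \<one>\<^bsub>C a\<^esub> = \<one>\<^bsub>C b\<^esub>"
  using connecting by (auto simp: unital_star_hom_def)

abbreviation J where "J \<equiv> null_ideal D C"

lemma null_ideal_iff:
  "F \<in> J \<longleftrightarrow> F \<in> carrier P \<and> (\<forall>e>0. \<exists>a\<in>D. \<forall>b\<in>D. a \<le> b \<longrightarrow> cnorm (C b) (F b) < e)"
proof (cases "F \<in> carrier P")
  case True
  then have "0 \<le> cnorm (C b) (F b)" if "b \<in> D" for b
    using normed_star_algebra.norm_nonneg[OF algebras] prod_component that by blast
  then show ?thesis
    using True by (auto simp: null_ideal_def tendsto_iff eventually_tail_filter[OF directed])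
qed (simp add: null_ideal_def)

lemma null_idealD:
  assumes "F \<in> J" "e > 0"
  obtains a where "a \<in> D" "\<And>b. \<lbrakk>b \<in> D; a \<le> b\<rbrakk> \<Longrightarrow> cnorm (C b) (F b) < e"
proof -
  have "\<exists>a\<in>D. \<forall>b\<in>D. a \<le> b \<longrightarrow> cnorm (C b) (F b) < e"
    using assms unfolding null_ideal_iff by simp
  then show ?thesis using that by blast
qed

lemma null_idealI_eventually_zero:
  assumes "F \<in> carrier P" "a \<in> D" "\<And>b. \<lbrakk>b \<in> D; a \<le> b\<rbrakk> \<Longrightarrow> F b = \<zero>\<^bsub>C b\<^esub>"
  shows "F \<in> J"
  unfolding null_ideal_iff
proof (intro conjI allI impI assms(1))
  fix e :: real assume "e > 0"
  then have "cnorm (C b) (F b) < e" if "b \<in> D" "a \<le> b" for b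
    using that assms(3) normed_star_algebra.norm_zero[OF algebras] by simp
  then show "\<exists>a\<in>D. \<forall>b\<in>D. a \<le> b \<longrightarrow> cnorm (C b) (F b) < e" using assms(2) by blast
qed

text \<open>This gives the absorption properties of the ideal: multiplying a null family by a bounded one, or
taking adjoints, changes the coordinate norms by at most a constant factor.\<close>

lemma null_idealI_dominated:
  assumes F: "F \<in> J" and G: "G \<in> carrier P" 
    and le: "\<And>b. b \<in> D \<Longrightarrow> cnorm (C b) (G b) \<le> M * cnorm (C b) (F b)"
  shows "G \<in> J"
  unfolding null_ideal_iff
proof (intro conjI allI impI G)
  fix e :: real assume "e > 0"
  \<comment> \<open>positive, so that one can divide by it\<close>
  define M' where "M' = max M 1"
  have "M' > 0" "M \<le> M'" by (auto simp: M'_def)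
  obtain a where a: "a \<in> D" "\<And>b. \<lbrakk>b \<in> D; a \<le> b\<rbrakk> \<Longrightarrow> cnorm (C b) (F b) < e / M'"
    using null_idealD[OF F, of "e / M'"] \<open>e > 0\<close> \<open>M' > 0\<close> by auto
  have "cnorm (C b) (G b) < e" if b: "b \<in> D" "a \<le> b" for b
  proof -
    have "0 \<le> cnorm (C b) (F b)"
      using F b normed_star_algebra.norm_nonneg[OF algebras prod_component] null_ideal_iff by blast
    then have "cnorm (C b) (G b) \<le> M' * cnorm (C b) (F b)"
      using le[OF b(1)] mult_right_mono[OF \<open>M \<le> M'\<close>] by (meson order_trans)
    also have "\<dots> < e" using a(2)[OF b] \<open>M' > 0\<close> by (simp add: field_simps)
    finally show ?thesis .
  qed
  then show "\<exists>a\<in>D. \<forall>b\<in>D. a \<le> b \<longrightarrow> cnorm (C b) (G b) < e" using a(1) by blast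
qed

lemma closed_star_ideal_null: "closed_star_ideal P J"
proof (unfold_locales, goal_cases)
  case 1
  show ?case using null_ideal_iff by blast
next
  case 2
  obtain a where "a \<in> D" using nonempty by blast
  then show ?case by (rule null_idealI_eventually_zero[OF prod.zero_closed]) simp
next
  case (3 F G)
  have FG: "F \<in> carrier P" "G \<in> carrier P" using 3 null_ideal_iff by blast+
  show ?case unfolding null_ideal_iff
  proof (intro conjI allI impI)
    show "F \<oplus>\<^bsub>P\<^esub> G \<in> carrier P" by (rule prod.a_closed[OF FG])
    fix e :: real assume "e > 0"
    then obtain a b where ab: "a \<in> D" "b \<in> D"
      and a: "\<And>c. \<lbrakk>c \<in> D; a \<le> c\<rbrakk> \<Longrightarrow> cnorm (C c) (F c) < e / 2"
      and b: "\<And>c. \<lbrakk>c \<in> D; b \<le> c\<rbrakk> \<Longrightarrow> cnorm (C c) (G c) < e / 2"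
      using null_idealD[OF 3(1), of "e / 2"] null_idealD[OF 3(2), of "e / 2"] by (metis half_gt_zero)
    obtain d where d: "d \<in> D" "a \<le> d" "b \<le> d" using upper_bound[OF ab] by blast
    have "cnorm (C c) ((F \<oplus>\<^bsub>P\<^esub> G) c) < e" if c: "c \<in> D" "d \<le> c" for c
    proof -
      have "cnorm (C c) (F c \<oplus>\<^bsub>C c\<^esub> G c) \<le> cnorm (C c) (F c) + cnorm (C c) (G c)"
        by (intro normed_star_algebra.norm_triangle[OF algebras] prod_component FG c)
      also have "\<dots> < e" using a[of c] b[of c] c d by fastforce
      finally show ?thesis using c by simp
    qed
    then show "\<exists>a\<in>D. \<forall>b\<in>D. a \<le> b \<longrightarrow> cnorm (C b) ((F \<oplus>\<^bsub>P\<^esub> G) b) < e" using d by blast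
  qed
next
  case (4 F G)
  then have G: "G \<in> carrier P" using null_ideal_iff by blast
  show ?case
  proof (rule null_idealI_dominated[OF 4(2)])
    fix b assume b: "b \<in> D"
    interpret Cb: normed_star_algebra "C b" by (rule algebras[OF b])
    show "cnorm (C b) ((F \<otimes>\<^bsub>P\<^esub> G) b) \<le> cnorm P F * cnorm (C b) (G b)"
      using 4(1) G b by (auto intro!: order_trans[OF Cb.norm_mult] mult_right_mono norm_component_le simp: prod_component)
  qed (rule prod.m_closed[OF 4(1) G])
next
  case (5 F G)
  then have F: "F \<in> carrier P" using null_ideal_iff by blast
  show ?case
  proof (rule null_idealI_dominated[OF 5(1)])
    fix b assume b: "b \<in> D"
    interpret Cb: normed_star_algebra "C b" by (rule algebras[OF b])
    show "cnorm (C b) ((F \<otimes>\<^bsub>P\<^esub> G) b) \<le> cnorm P G * cnorm (C b) (F b)"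
      using 5(2) F b 
      by (subst mult.commute)
        (auto intro!: order_trans[OF Cb.norm_mult] mult_left_mono norm_component_le simp: prod_component)
  qed (rule prod.m_closed[OF F 5(2)])
next
  case (6 F)
  then have F: "F \<in> carrier P" using null_ideal_iff by blast
  show ?case
  proof (rule null_idealI_dominated[OF 6, where M = 1])
    fix b assume b: "b \<in> D"
    show "cnorm (C b) (star P F b) \<le> 1 * cnorm (C b) (F b)"
      using b normed_star_algebra.norm_star[OF algebras[OF b] prod_component[OF F b]] by simp
  qed (rule prod.star_closed[OF F])
next
  case (7 F)
  show ?case unfolding null_ideal_iff
  proof (intro conjI allI impI 7)
    fix e :: real assume "e > 0"
    then obtain G where G: "G \<in> J" and FG: "cnorm P (F \<ominus>\<^bsub>P\<^esub> G) < e / 2"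
      using 7(2)[of "e / 2"] by auto
    have GP: "G \<in> carrier P" using G null_ideal_iff by blast
    obtain a where a: "a \<in> D" "\<And>b. \<lbrakk>b \<in> D; a \<le> b\<rbrakk> \<Longrightarrow> cnorm (C b) (G b) < e / 2"
      using null_idealD[OF G, of "e / 2"] \<open>e > 0\<close> by auto
    have "cnorm (C b) (F b) < e" if b: "b \<in> D" "a \<le> b" for b
    proof -
      have "cnorm (C b) (F b) \<le> cnorm (C b) (F b \<ominus>\<^bsub>C b\<^esub> G b) + cnorm (C b) (G b)"
        by (intro normed_star_algebra.norm_le_norm_minus[OF algebras] prod_component 7 GP b)
      also have "cnorm (C b) (F b \<ominus>\<^bsub>C b\<^esub> G b) \<le> cnorm P (F \<ominus>\<^bsub>P\<^esub> G)"
        using norm_component_le[OF prod.minus_closed[OF 7(1) GP] b(1)] prod_minus[OF 7(1) GP b(1)] by simp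
      finally show ?thesis using a(2)[OF b] FG by simp
    qed
    then show "\<exists>a\<in>D. \<forall>b\<in>D. a \<le> b \<longrightarrow> cnorm (C b) (F b) < e" using a(1) by blast
  qed
qed

sublocale null: closed_star_ideal P J by (rule closed_star_ideal_null)

abbreviation Q where "Q \<equiv> quotient_cstar P J"

lemma theta_star_hom:
  assumes a: "a \<in> D"
  shows "theta D C \<rho> a \<in> star_hom (C a) P"
proof -
  have mem: "theta D C \<rho> a x \<in> carrier P" if x: "x \<in> carrier (C a)" for x
  proof (rule carrier_prodI)
    fix b assume b: "b \<in> D"
    interpret Cb: normed_star_algebra "C b" by (rule algebras[OF b])
    show "theta D C \<rho> a x b \<in> carrier (C b)"
      using star_homD(1)[OF connecting_hom[OF a b]] x b by (simp add: theta_def)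
    show "cnorm (C b) (theta D C \<rho> a x b) \<le> cnorm (C a) x"
      using connecting_contractive[OF a b _ x] b normed_star_algebra.norm_nonneg[OF algebras[OF a] x]
      by (simp add: theta_def)
  qed (simp add: theta_def)
  note hom = star_homD[OF connecting_hom[OF a]]
  have eqs: "theta D C \<rho> a (x \<oplus>\<^bsub>C a\<^esub> y) = theta D C \<rho> a x \<oplus>\<^bsub>P\<^esub> theta D C \<rho> a y"
    "theta D C \<rho> a (x \<otimes>\<^bsub>C a\<^esub> y) = theta D C \<rho> a x \<otimes>\<^bsub>P\<^esub> theta D C \<rho> a y"
    "theta D C \<rho> a (c \<odot>\<^bsub>C a\<^esub> x) = c \<odot>\<^bsub>P\<^esub> theta D C \<rho> a x"
    "theta D C \<rho> a (star (C a) x) = star P (theta D C \<rho> a x)"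
    if x: "x \<in> carrier (C a)" and y: "y \<in> carrier (C a)" for x y c
  proof -
    have "\<zero>\<^bsub>C b\<^esub> \<oplus>\<^bsub>C b\<^esub> \<zero>\<^bsub>C b\<^esub> = \<zero>\<^bsub>C b\<^esub>" "\<zero>\<^bsub>C b\<^esub> \<otimes>\<^bsub>C b\<^esub> \<zero>\<^bsub>C b\<^esub> = \<zero>\<^bsub>C b\<^esub>"
      "c \<odot>\<^bsub>C b\<^esub> \<zero>\<^bsub>C b\<^esub> = \<zero>\<^bsub>C b\<^esub>" "star (C b) \<zero>\<^bsub>C b\<^esub> = \<zero>\<^bsub>C b\<^esub>" if "b \<in> D" for b
    proof -
      interpret Cb: normed_star_algebra "C b" by (rule algebras[OF that])
      show "\<zero>\<^bsub>C b\<^esub> \<oplus>\<^bsub>C b\<^esub> \<zero>\<^bsub>C b\<^esub> = \<zero>\<^bsub>C b\<^esub>" "\<zero>\<^bsub>C b\<^esub> \<otimes>\<^bsub>C b\<^esub> \<zero>\<^bsub>C b\<^esub> = \<zero>\<^bsub>C b\<^esub>"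
        "c \<odot>\<^bsub>C b\<^esub> \<zero>\<^bsub>C b\<^esub> = \<zero>\<^bsub>C b\<^esub>" "star (C b) \<zero>\<^bsub>C b\<^esub> = \<zero>\<^bsub>C b\<^esub>" by simp_all
    qed
    then show "theta D C \<rho> a (x \<oplus>\<^bsub>C a\<^esub> y) = theta D C \<rho> a x \<oplus>\<^bsub>P\<^esub> theta D C \<rho> a y"
      "theta D C \<rho> a (x \<otimes>\<^bsub>C a\<^esub> y) = theta D C \<rho> a x \<otimes>\<^bsub>P\<^esub> theta D C \<rho> a y"
      "theta D C \<rho> a (c \<odot>\<^bsub>C a\<^esub> x) = c \<odot>\<^bsub>P\<^esub> theta D C \<rho> a x"
      "theta D C \<rho> a (star (C a) x) = star P (theta D C \<rho> a x)"
      using x y by (auto simp: theta_def hom fun_eq_iff)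
  qed
  show ?thesis
    unfolding star_hom_def using eqs mem by blast
qed

lemma theta_in_prod: "\<lbrakk>a \<in> D; x \<in> carrier (C a)\<rbrakk> \<Longrightarrow> theta D C \<rho> a x \<in> carrier P"
  by (rule star_homD(1)[OF theta_star_hom])

lemma theta_norm_le:
  assumes "a \<in> D" "x \<in> carrier (C a)"
  shows "cnorm P (theta D C \<rho> a x) \<le> cnorm (C a) x"
proof (rule norm_prod_le)
  fix b assume b: "b \<in> D"
  then show "cnorm (C b) (theta D C \<rho> a x b) \<le> cnorm (C a) x"
    using assms connecting_contractive[OF assms(1) b _ assms(2)]
      normed_star_algebra.norm_zero[OF algebras[OF b]] normed_star_algebra.norm_nonneg[OF algebras[OF assms(1)]]
    by (simp add: theta_def)
qed

text \<open>The two families agree from index \<open>b\<close> on, and families that vanish from some index on are null.\<close>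

lemma limit_map_connecting:
  assumes ab: "a \<in> D" "b \<in> D" "a \<le> b" and x: "x \<in> carrier (C a)"
  shows "limit_map D C \<rho> a x = limit_map D C \<rho> b (\<rho> b a x)"
proof -
  have y: "\<rho> b a x \<in> carrier (C b)" by (rule star_homD(1)[OF connecting_hom[OF ab] x])
  note th = theta_in_prod[OF ab(1) x] theta_in_prod[OF ab(2) y]
  have "theta D C \<rho> a x \<ominus>\<^bsub>P\<^esub> theta D C \<rho> b (\<rho> b a x) \<in> J"
  proof (rule null_idealI_eventually_zero[OF prod.minus_closed[OF th] ab(2)])
    fix c assume c: "c \<in> D" "b \<le> c"
    interpret Cc: normed_star_algebra "C c" by (rule algebras[OF c(1)])
    have "a \<le> c" using ab c by simp
    then have "theta D C \<rho> a x c = theta D C \<rho> b (\<rho> b a x) c"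
      using connecting_comp[OF ab(1,2) c(1) ab(3) c(2) x] c by (simp add: theta_def)
    then show "(theta D C \<rho> a x \<ominus>\<^bsub>P\<^esub> theta D C \<rho> b (\<rho> b a x)) c = \<zero>\<^bsub>C c\<^esub>"
      using prod_component[OF th(2) c(1)] by (simp add: prod_minus[OF th c(1)])
  qed
  then show ?thesis unfolding limit_map_def using th by (simp add: null.coset_eq_iff)
qed

lemma limit_map_one:
  assumes a: "a \<in> D"
  shows "limit_map D C \<rho> a \<one>\<^bsub>C a\<^esub> = \<one>\<^bsub>Q\<^esub>"
proof -
  interpret Ca: normed_star_algebra "C a" by (rule algebras[OF a])
  note th = theta_in_prod[OF a Ca.one_closed] prod.one_closed
  have "theta D C \<rho> a \<one>\<^bsub>C a\<^esub> \<ominus>\<^bsub>P\<^esub> \<one>\<^bsub>P\<^esub> \<in> J"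
  proof (rule null_idealI_eventually_zero[OF prod.minus_closed[OF th] a])
    fix c assume c: "c \<in> D" "a \<le> c"
    interpret Cc: normed_star_algebra "C c" by (rule algebras[OF c(1)])
    have "theta D C \<rho> a \<one>\<^bsub>C a\<^esub> c = \<one>\<^bsub>P\<^esub> c"
      using c connecting_one[OF a c] by (simp add: theta_def)
    then show "(theta D C \<rho> a \<one>\<^bsub>C a\<^esub> \<ominus>\<^bsub>P\<^esub> \<one>\<^bsub>P\<^esub>) c = \<zero>\<^bsub>C c\<^esub>"
      using prod_component[OF th(2) c(1)] by (simp only: prod_minus[OF th c(1)] Cc.minus_self)
  qed
  then show ?thesis unfolding limit_map_def null.quotient_ops using th by (simp add: null.coset_eq_iff del: prod_ops)
qed

lemma limit_map_star_hom_quotient: 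
  assumes a: "a \<in> D" 
  shows "limit_map D C \<rho> a \<in> star_hom (C a) Q"
  unfolding limit_map_def star_hom_def
proof (intro CollectI conjI ballI allI funcsetI)
qed (simp_all only: theta_in_prod[OF a] star_homD(2-5)[OF theta_star_hom[OF a]] null.quotient_ops(4,5)
      null.quotient_smult null.quotient_star null.coset_in_quotient)

text \<open>Together with the next lemma: the norm of the image of \<open>x\<close> in the limit is the infimum of
\<open>\<parallel>\<rho> b a x\<parallel>\<close> over \<open>b \<ge> a\<close>. That the embedding is isometric rests on this formula.\<close>

lemma limit_map_norm_le:
  assumes ab: "a \<in> D" "b \<in> D" "a \<le> b" and x: "x \<in> carrier (C a)"
  shows "cnorm Q (limit_map D C \<rho> a x) \<le> cnorm (C b) (\<rho> b a x)"
proof -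
  have y: "\<rho> b a x \<in> carrier (C b)" by (rule star_homD(1)[OF connecting_hom[OF ab] x])
  show ?thesis
    unfolding limit_map_connecting[OF ab x] unfolding limit_map_def
    using null.quotient_norm_le_rep[OF theta_in_prod[OF ab(2) y]] theta_norm_le[OF ab(2) y] by simp
qed

lemma limit_map_norm_approx:
  assumes a: "a \<in> D" and x: "x \<in> carrier (C a)" and e: "e > 0"
  obtains b where "b \<in> D" "a \<le> b" "cnorm (C b) (\<rho> b a x) < cnorm Q (limit_map D C \<rho> a x) + e"
proof -
  note th = theta_in_prod[OF a x]
  \<comment> \<open>a representative of almost minimal norm, which from some index on is close to \<open>\<rho> b a x\<close>\<close>
  have "cnorm Q (null.coset (theta D C \<rho> a x)) < cnorm Q (limit_map D C \<rho> a x) + e / 2"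
    using e by (simp add: limit_map_def)
  then obtain G where G: "G \<in> carrier P" "null.coset G = null.coset (theta D C \<rho> a x)"
    "cnorm P G < cnorm Q (limit_map D C \<rho> a x) + e / 2"
    by (rule null.quotient_norm_less[OF th])
  then have "theta D C \<rho> a x \<ominus>\<^bsub>P\<^esub> G \<in> J" using th null.coset_eq_iff by metis
  then obtain c where c: "c \<in> D" "\<And>b. \<lbrakk>b \<in> D; c \<le> b\<rbrakk> \<Longrightarrow> cnorm (C b) ((theta D C \<rho> a x \<ominus>\<^bsub>P\<^esub> G) b) < e / 2"
    using null_idealD[of _ "e / 2"] e by (metis half_gt_zero)
  obtain b where b: "b \<in> D" "a \<le> b" "c \<le> b" using upper_bound[OF a c(1)] by blast
  have "cnorm (C b) (\<rho> b a x) = cnorm (C b) (theta D C \<rho> a x b)" using b by (simp add: theta_def)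
  also have "\<dots> \<le> cnorm (C b) (theta D C \<rho> a x b \<ominus>\<^bsub>C b\<^esub> G b) + cnorm (C b) (G b)"
    by (intro normed_star_algebra.norm_le_norm_minus[OF algebras] prod_component th G b)
  also have "\<dots> < e / 2 + (cnorm Q (limit_map D C \<rho> a x) + e / 2)"
    using c(2)[OF b(1,3)] G(3) norm_component_le[OF G(1) b(1)] by (simp add: prod_minus[OF th G(1) b(1)])
  finally show thesis using b that by simp
qed

abbreviation U where "U \<equiv> \<Union>a\<in>D. limit_map D C \<rho> a ` carrier (C a)"

text \<open>By directedness, two elements of the union come from a common index, where they can be added and
multiplied.\<close>

lemma unital_star_subalgebra_union: "unital_star_subalgebra Q U"
proof -
  note hom = limit_map_star_hom_quotient
  have two: "\<exists>c\<in>D. \<exists>x\<in>carrier (C c). \<exists>y\<in>carrier (C c). X = limit_map D C \<rho> c x \<and> Y = limit_map D C \<rho> c y"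
    if XY: "X \<in> U" "Y \<in> U" for X Y
  proof -
    obtain a b x y where ab: "a \<in> D" "b \<in> D" "x \<in> carrier (C a)" "y \<in> carrier (C b)"
      "X = limit_map D C \<rho> a x" "Y = limit_map D C \<rho> b y" using XY by blast
    obtain c where c: "c \<in> D" "a \<le> c" "b \<le> c" using upper_bound[OF ab(1,2)] by blast
    have "X = limit_map D C \<rho> c (\<rho> c a x)" "Y = limit_map D C \<rho> c (\<rho> c b y)"
      using limit_map_connecting[OF ab(1) c(1,2) ab(3)] limit_map_connecting[OF ab(2) c(1,3) ab(4)] ab(5,6)
      by simp_all
    moreover have "\<rho> c a x \<in> carrier (C c)" "\<rho> c b y \<in> carrier (C c)"
      using star_homD(1)[OF connecting_hom] ab c by blast+
    ultimately show ?thesis using c by blast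
  qed
  have ring: "ring (C a)" and sa: "star_algebra (C a)" if "a \<in> D" for a
    using algebras[OF that] by (auto simp: normed_star_algebra_def star_algebra_def)
  show ?thesis
  proof (unfold_locales, goal_cases)
    case 1
    show ?case using star_homD(1)[OF hom] by blast
  next
    case 2
    obtain a where a: "a \<in> D" using nonempty by blast
    have "limit_map D C \<rho> a \<one>\<^bsub>C a\<^esub> \<in> U"
      by (rule UN_I, rule a, rule imageI, rule ring.ring_simprules(6)[OF ring[OF a]])
    then show ?case by (simp only: limit_map_one[OF a])
  next
    case (3 X Y)
    obtain c x y where c: "c \<in> D" and xy: "x \<in> carrier (C c)" "y \<in> carrier (C c)"
      and eq: "X = limit_map D C \<rho> c x" "Y = limit_map D C \<rho> c y" using two[OF 3] by blast
    have "X \<oplus>\<^bsub>Q\<^esub> Y = limit_map D C \<rho> c (x \<oplus>\<^bsub>C c\<^esub> y)"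
      unfolding eq by (rule star_homD(2)[OF hom[OF c] xy, symmetric])
    then show ?case using ring.ring_simprules(1)[OF ring[OF c] xy] c by blast
  next
    case (4 X Y)
    obtain c x y where c: "c \<in> D" and xy: "x \<in> carrier (C c)" "y \<in> carrier (C c)"
      and eq: "X = limit_map D C \<rho> c x" "Y = limit_map D C \<rho> c y" using two[OF 4] by blast
    have "X \<otimes>\<^bsub>Q\<^esub> Y = limit_map D C \<rho> c (x \<otimes>\<^bsub>C c\<^esub> y)"
      unfolding eq by (rule star_homD(3)[OF hom[OF c] xy, symmetric])
    then show ?case using ring.ring_simprules(5)[OF ring[OF c] xy] c by blast
  next
    case (5 X z)
    then obtain c x where c: "c \<in> D" and x: "x \<in> carrier (C c)" and eq: "X = limit_map D C \<rho> c x"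
      by blast
    have "z \<odot>\<^bsub>Q\<^esub> X = limit_map D C \<rho> c (z \<odot>\<^bsub>C c\<^esub> x)"
      unfolding eq by (rule star_homD(4)[OF hom[OF c] x, symmetric])
    then show ?case using star_algebra.smult_closed[OF sa[OF c] x] c by blast
  next
    case (6 X)
    then obtain c x where c: "c \<in> D" and x: "x \<in> carrier (C c)" and eq: "X = limit_map D C \<rho> c x"
      by blast
    have "star Q X = limit_map D C \<rho> c (star (C c) x)"
      unfolding eq by (rule star_homD(5)[OF hom[OF c] x, symmetric])
    then show ?case using star_algebra.star_closed[OF sa[OF c] x] c by blast
  qed
qed

lemma inductive_limit_eq: 
  "inductive_limit D C \<rho> = Q\<lparr>carrier := norm_topology Q closure_of U\<rparr>"
  by (simp add: inductive_limit_def Let_def)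

sublocale union: unital_star_subalgebra Q U
  by (rule unital_star_subalgebra_union)

sublocale lim: unital_star_subalgebra Q "norm_topology Q closure_of U"
  by (rule union.unital_star_subalgebra_closure)

lemma normed_star_algebra_limit: "normed_star_algebra (inductive_limit D C \<rho>)"
  unfolding inductive_limit_eq by (rule lim.normed_star_algebra_sub)

lemma mcomplete_limit:
  assumes "\<And>a. a \<in> D \<Longrightarrow> Metric_space.mcomplete (carrier (C a)) (cdist (C a))"
  shows "Metric_space.mcomplete (carrier (inductive_limit D C \<rho>)) (cdist (inductive_limit D C \<rho>))"
  unfolding inductive_limit_eq
proof (rule lim.mcomplete_sub)
  show "null.quot.metric.mcomplete"
    by (rule null.mcomplete_quotient[OF mcomplete_prod[OF assms]])
qed (rule union.closure_sequentially_closed, assumption+)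

lemma limit_simps:
  "carrier (inductive_limit D C \<rho>) = norm_topology Q closure_of U"
  "cnorm (inductive_limit D C \<rho>) = cnorm Q" "star (inductive_limit D C \<rho>) = star Q"
  "add (inductive_limit D C \<rho>) = add Q" "monoid.mult (inductive_limit D C \<rho>) = monoid.mult Q"
  "smult (inductive_limit D C \<rho>) = smult Q" "one (inductive_limit D C \<rho>) = one Q"
  by (simp_all add: inductive_limit_eq)

lemma union_subset_limit: "U \<subseteq> carrier (inductive_limit D C \<rho>)"
proof
  fix X assume X: "X \<in> U"
  then have "null.quot.tends (\<lambda>_. X) X"
    by (intro null.quot.tends_const union.sub_in_carrier)
  then show "X \<in> carrier (inductive_limit D C \<rho>)"
    unfolding limit_simps null.quot.in_closure_iff[OF union.sub_carrier]
    using X by (intro exI[of _ "\<lambda>_. X"]) blast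
qed

lemma limit_map_star_hom:
  assumes a: "a \<in> D"
  shows "limit_map D C \<rho> a \<in> star_hom (C a) (inductive_limit D C \<rho>)"
proof -
  have "limit_map D C \<rho> a x \<in> carrier (inductive_limit D C \<rho>)" if "x \<in> carrier (C a)" for x
    using union_subset_limit a that by blast
  then show ?thesis
    using star_homD(2-5)[OF limit_map_star_hom_quotient[OF a]]
    unfolding star_hom_def by (simp add: limit_simps(2-))
qed

lemma limit_map_contractive:
  assumes a: "a \<in> D" and x: "x \<in> carrier (C a)"
  shows "cnorm (inductive_limit D C \<rho>) (limit_map D C \<rho> a x) \<le> cnorm (C a) x"
  using limit_map_norm_le[OF a a order_refl x] connecting_contractive[OF a a order_refl x]
  by (simp add: limit_simps)

end

section \<open>The limit over one directed set inside the limit of products\<close>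

text \<open>The second assumption, that a larger index lies in fewer of the directed sets, is what makes
restriction a map from the product at \<open>a\<close> to the product at \<open>b\<close>. For maximal directed sets it
holds because they are downward closed.\<close>

locale normed_star_system_family =
  fixes I :: "'i set" and Ki :: "'i \<Rightarrow> 'k::order set"
    and A :: "'k \<Rightarrow> ('a, 'm) cstar_struct_scheme" and \<sigma> :: "'k \<Rightarrow> 'k \<Rightarrow> 'a \<Rightarrow> 'a"
  assumes systems: "j \<in> I \<Longrightarrow> normed_star_system (Ki j) A \<sigma>"
    and U_antimono: "\<lbrakk>i \<in> I; a \<in> Ki i; b \<in> Ki i; a \<le> b\<rbrakk> \<Longrightarrow> U_set I Ki b \<subseteq> U_set I Ki a"
begin

abbreviation U where "U \<equiv> U_set I Ki"
abbreviation L where "L \<equiv> A_limit Ki A \<sigma>"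
abbreviation B where "B \<equiv> B_alg I Ki A \<sigma>"

lemma U_iff: "j \<in> U a \<longleftrightarrow> j \<in> I \<and> a \<in> Ki j"
  by (simp add: U_set_def)

lemma L_algebra: "j \<in> I \<Longrightarrow> normed_star_algebra (L j)"
  unfolding A_limit_def by (rule normed_star_system.normed_star_algebra_limit[OF systems])

lemma B_family:
  assumes "i \<in> I" "a \<in> Ki i"
  shows "normed_star_algebra_family (U a) L"
  by (rule normed_star_algebra_family.intro) (use assms L_algebra in \<open>auto simp: U_iff\<close>)

lemma B_algebra: "\<lbrakk>i \<in> I; a \<in> Ki i\<rbrakk> \<Longrightarrow> normed_star_algebra (B a)"
  unfolding B_alg_def by (rule normed_star_algebra_family.normed_star_algebra_prod[OF B_family])

definition diag :: "'k \<Rightarrow> 'a \<Rightarrow> 'i \<Rightarrow> ('k \<Rightarrow> 'a) set" where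
  "diag a x = (\<lambda>j\<in>U a. limit_map (Ki j) A \<sigma> a x)"

lemma diag_star_hom:
  assumes i: "i \<in> I" "a \<in> Ki i"
  shows "diag a \<in> star_hom (A a) (B a)"
proof -
  interpret Ba: normed_star_algebra_family "U a" L by (rule B_family[OF i])
  have hom: "limit_map (Ki j) A \<sigma> a \<in> star_hom (A a) (L j)" if "j \<in> U a" for j
    using normed_star_system.limit_map_star_hom[OF systems] that by (simp add: U_iff A_limit_def)
  have mem: "diag a x \<in> carrier (B a)" if x: "x \<in> carrier (A a)" for x
    unfolding B_alg_def
  proof (rule Ba.carrier_prodI)
    fix j assume j: "j \<in> U a"
    show "diag a x j \<in> carrier (L j)" using star_homD(1)[OF hom[OF j] x] j by (simp add: diag_def)
    show "cnorm (L j) (diag a x j) \<le> cnorm (A a) x"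
      using normed_star_system.limit_map_contractive[OF systems _ x] j 
      by (simp add: U_iff A_limit_def diag_def)
  qed (simp add: diag_def)
  show ?thesis
    unfolding star_hom_def
    by (simp add: mem) (auto simp: B_alg_def diag_def bounded_prod_def fun_eq_iff star_homD[OF hom])
qed

lemma diag_contractive:
  assumes i: "i \<in> I" "a \<in> Ki i" and x: "x \<in> carrier (A a)"
  shows "cnorm (B a) (diag a x) \<le> cnorm (A a) x"
  unfolding B_alg_def
proof (rule normed_star_algebra_family.norm_prod_le[OF B_family[OF i]])
  fix j assume j: "j \<in> U a"
  then show "cnorm (L j) (diag a x j) \<le> cnorm (A a) x"
    using normed_star_system.limit_map_contractive[OF systems _ x] 
    by (simp add: U_iff A_limit_def diag_def)
qed

lemma tau_unital_star_hom:
  assumes i: "i \<in> I" "a \<in> Ki i" "b \<in> Ki i" "a \<le> b"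
  shows "tau I Ki b a \<in> unital_star_hom (B a) (B b)"
    and "f \<in> carrier (B a) \<Longrightarrow> cnorm (B b) (tau I Ki b a f) \<le> cnorm (B a) f"
proof -
  interpret Ba: normed_star_algebra_family "U a" L by (rule B_family[OF i(1,2)])
  interpret Bb: normed_star_algebra_family "U b" L by (rule B_family[OF i(1,3)])
  have sub: "j \<in> U a" if "j \<in> U b" for j using U_antimono[OF i] that by blast
  have mem: "tau I Ki b a f \<in> carrier (B b)" if f: "f \<in> carrier (B a)" for f
    unfolding B_alg_def
    by (rule Bb.carrier_prodI[of _ "cnorm (B a) f"])
      (use f sub Ba.prod_component Ba.norm_component_le in \<open>auto simp: B_alg_def tau_def\<close>)
  show "tau I Ki b a \<in> unital_star_hom (B a) (B b)"
    unfolding unital_star_hom_def star_hom_def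
    by (simp add: mem) (auto simp: B_alg_def tau_def bounded_prod_def fun_eq_iff sub)
  show "cnorm (B b) (tau I Ki b a f) \<le> cnorm (B a) f" if f: "f \<in> carrier (B a)"
    unfolding B_alg_def
    by (rule Bb.norm_prod_le) (use f sub Ba.norm_component_le in \<open>auto simp: B_alg_def tau_def\<close>)
qed

lemma B_system:
  assumes i: "i \<in> I"
  shows "normed_star_system (Ki i) B (tau I Ki)"
proof -
  interpret A: normed_star_system "Ki i" A \<sigma> by (rule systems[OF i])
  show ?thesis
  proof (intro normed_star_system.intro normed_star_algebra_family.intro normed_star_system_axioms.intro)
    show "tau I Ki c a f = tau I Ki c b (tau I Ki b a f)" 
      if "a \<in> Ki i" "b \<in> Ki i" "c \<in> Ki i" "a \<le> b" "b \<le> c" for a b c f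
      using U_antimono[OF i that(2,3,5)] by (auto simp: tau_def fun_eq_iff)
  qed (use A.nonempty A.directed B_algebra[OF i] tau_unital_star_hom[OF i] in auto)
qed

text \<open>The maps \<open>diag a\<close> form a morphism from the given system to the system of products.\<close>

lemma tau_diag:
  assumes i: "i \<in> I" "a \<in> Ki i" "b \<in> Ki i" "a \<le> b" and x: "x \<in> carrier (A a)"
  shows "tau I Ki b a (diag a x) = diag b (\<sigma> b a x)"
proof -
  have "limit_map (Ki j) A \<sigma> a x = limit_map (Ki j) A \<sigma> b (\<sigma> b a x)" if "j \<in> U b" for j
    using that U_antimono[OF i] normed_star_system.limit_map_connecting[OF systems _ _ i(4) x]
    by (auto simp: U_iff)
  then show ?thesis using U_antimono[OF i] by (auto simp: tau_def diag_def fun_eq_iff)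
qed

text \<open>The embedding is defined on all bounded families and then passed to the quotients. This gives a
contractive *-homomorphism between the full quotient algebras at once, in place of an extension by
continuity from the dense union.\<close>

definition diag_prod :: "'i \<Rightarrow> ('k \<Rightarrow> 'a) \<Rightarrow> 'k \<Rightarrow> 'i \<Rightarrow> ('k \<Rightarrow> 'a) set" where
  "diag_prod i F = (\<lambda>a\<in>Ki i. diag a (F a))"

lemma diag_prod_ideal_hom:
  assumes i: "i \<in> I"
  shows "contractive_ideal_hom (bounded_prod (Ki i) A) (null_ideal (Ki i) A)
    (bounded_prod (Ki i) B) (null_ideal (Ki i) B) (diag_prod i)"
proof -
  interpret A: normed_star_system "Ki i" A \<sigma> by (rule systems[OF i])
  interpret B: normed_star_system "Ki i" B "tau I Ki" by (rule B_system[OF i])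
  note hom = star_homD[OF diag_star_hom[OF i]]
  have le: "cnorm (B a) (diag_prod i F a) \<le> cnorm (A a) (F a)" if "F \<in> carrier A.P" "a \<in> Ki i" for F a
    using diag_contractive[OF i that(2)] A.prod_component[OF that] that(2) by (simp add: diag_prod_def)
  have le': "cnorm (B a) (diag_prod i F a) \<le> cnorm A.P F" if "F \<in> carrier A.P" "a \<in> Ki i" for F a
    using le[OF that] A.norm_component_le[OF that] by linarith
  have mem: "diag_prod i F \<in> carrier B.P" if F: "F \<in> carrier A.P" for F
  proof (rule B.carrier_prodI[OF _ _ le'[OF F]])
    show "diag_prod i F \<in> extensional (Ki i)" unfolding diag_prod_def by (rule restrict_extensional)
    show "diag_prod i F a \<in> carrier (B a)" if "a \<in> Ki i" for a
      using hom(1)[OF that A.prod_component[OF F that]] that by (simp add: diag_prod_def)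
  qed
  show ?thesis
  proof unfold_locales
    show "diag_prod i \<in> star_hom A.P B.P"
      unfolding star_hom_def
      by (simp add: mem del: A.prod_ops B.prod_ops)
        (auto simp: diag_prod_def fun_eq_iff hom A.prod_component)
    show "cnorm B.P (diag_prod i F) \<le> cnorm A.P F" if "F \<in> carrier A.P" for F
      by (rule B.norm_prod_le[OF le'[OF that]])
    show "diag_prod i F \<in> B.J" if F: "F \<in> A.J" for F
    proof -
      have FP: "F \<in> carrier A.P" using F A.null_ideal_iff by blast
      show ?thesis unfolding B.null_ideal_iff
      proof (intro conjI allI impI mem FP)
        fix e :: real assume "e > 0"
        then obtain a where "a \<in> Ki i" "\<And>b. \<lbrakk>b \<in> Ki i; a \<le> b\<rbrakk> \<Longrightarrow> cnorm (A b) (F b) < e"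
          using A.null_idealD[OF F] by blast
        then show "\<exists>a\<in>Ki i. \<forall>b\<in>Ki i. a \<le> b \<longrightarrow> cnorm (B b) (diag_prod i F b) < e"
          using le[OF FP] by (meson le_less_trans)
      qed
    qed
  qed
qed

lemma diag_prod_theta:
  assumes i: "i \<in> I" "a \<in> Ki i" and x: "x \<in> carrier (A a)"
  shows "diag_prod i (theta (Ki i) A \<sigma> a x) = theta (Ki i) B (tau I Ki) a (diag a x)"
proof -
  interpret A: normed_star_system "Ki i" A \<sigma> by (rule systems[OF i(1)])
  have "diag b \<zero>\<^bsub>A b\<^esub> = \<zero>\<^bsub>B b\<^esub>" if b: "b \<in> Ki i" for b
    using star_hom_zero[OF _ _ diag_star_hom[OF i(1) b]] A.algebras[OF b] B_algebra[OF i(1) b]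
    by (simp add: normed_star_algebra_def)
  then show ?thesis
    using tau_diag[OF i _ _ x] by (auto simp: diag_prod_def theta_def fun_eq_iff)
qed

definition limit_embedding :: "'i \<Rightarrow> ('k \<Rightarrow> 'a) set \<Rightarrow> ('k \<Rightarrow> 'i \<Rightarrow> ('k \<Rightarrow> 'a) set) set" where
  "limit_embedding i = quotient_lift (bounded_prod (Ki i) B) (null_ideal (Ki i) B) (diag_prod i)"

lemma limit_embedding_limit_map:
  assumes i: "i \<in> I" "a \<in> Ki i" and x: "x \<in> carrier (A a)"
  shows "limit_embedding i (limit_map (Ki i) A \<sigma> a x) = limit_map (Ki i) B (tau I Ki) a (diag a x)"
proof -
  interpret A: normed_star_system "Ki i" A \<sigma> by (rule systems[OF i(1)])
  interpret C: contractive_ideal_hom "bounded_prod (Ki i) A" "null_ideal (Ki i) A"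
    "bounded_prod (Ki i) B" "null_ideal (Ki i) B" "diag_prod i"
    by (rule diag_prod_ideal_hom[OF i(1)])
  show ?thesis
    unfolding limit_embedding_def limit_map_def
    using C.quotient_lift_coset[OF A.theta_in_prod[OF i(2) x]] diag_prod_theta[OF i x] by simp
qed

text \<open>The heart of the matter. The norm in the limit of the products is approximated by the norm of the
family \<open>diag a x\<close> restricted to \<open>U b\<close>, for some \<open>b \<ge> a\<close> in \<open>Ki i\<close>. However large \<open>b\<close> is, the index
\<open>i\<close> itself survives in \<open>U b\<close>, and the coordinate at \<open>i\<close> is the image of \<open>x\<close> in the limit over
\<open>Ki i\<close>.\<close>

lemma limit_embedding_norm_ge:
  assumes i: "i \<in> I" "a \<in> Ki i" and x: "x \<in> carrier (A a)"
  shows "cnorm (L i) (limit_map (Ki i) A \<sigma> a x) 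
    \<le> cnorm (B_limit I Ki A \<sigma> i) (limit_embedding i (limit_map (Ki i) A \<sigma> a x))"
proof (rule field_le_epsilon)
  interpret B: normed_star_system "Ki i" B "tau I Ki" by (rule B_system[OF i(1)])
  fix e :: real assume "e > 0"
  have d: "diag a x \<in> carrier (B a)" by (rule star_homD(1)[OF diag_star_hom[OF i] x])
  obtain b where b: "b \<in> Ki i" "a \<le> b"
    and less: "cnorm (B b) (tau I Ki b a (diag a x)) 
      < cnorm B.Q (limit_map (Ki i) B (tau I Ki) a (diag a x)) + e"
    by (rule B.limit_map_norm_approx[OF i(2) d \<open>e > 0\<close>])
  have "tau I Ki b a (diag a x) \<in> carrier (B b)"
    by (rule star_homD(1)[OF B.connecting_hom[OF i(2) b] d])
  then have "cnorm (L i) (tau I Ki b a (diag a x) i) \<le> cnorm (B b) (tau I Ki b a (diag a x))"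
    unfolding B_alg_def
    using normed_star_algebra_family.norm_component_le[OF B_family[OF i(1) b(1)]] i(1) b(1)
    by (simp add: U_iff)
  moreover have "tau I Ki b a (diag a x) i = limit_map (Ki i) A \<sigma> a x"
    using i b by (simp add: tau_def diag_def U_iff)
  ultimately show "cnorm (L i) (limit_map (Ki i) A \<sigma> a x) 
      \<le> cnorm (B_limit I Ki A \<sigma> i) (limit_embedding i (limit_map (Ki i) A \<sigma> a x)) + e"
    using less by (simp add: B_limit_def B.limit_simps limit_embedding_limit_map[OF i x])
qed

text \<open>On the union of the images of the algebras \<open>A a\<close> the norm is preserved by the previous bound and
contractivity. The closure is reached by continuity, both for the norm and for the fact that
the embedding takes values in the closure of the union on the other side.\<close>

lemma limit_embedding_isometric_star_hom:
  assumes i: "i \<in> I"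
  shows "limit_embedding i \<in> star_hom (L i) (B_limit I Ki A \<sigma> i)"
    and "X \<in> carrier (L i) \<Longrightarrow> cnorm (B_limit I Ki A \<sigma> i) (limit_embedding i X) = cnorm (L i) X"
proof -
  interpret A: normed_star_system "Ki i" A \<sigma> by (rule systems[OF i])
  interpret B: normed_star_system "Ki i" B "tau I Ki" by (rule B_system[OF i])
  interpret C: contractive_ideal_hom "bounded_prod (Ki i) A" "null_ideal (Ki i) A"
    "bounded_prod (Ki i) B" "null_ideal (Ki i) B" "diag_prod i"
    by (rule diag_prod_ideal_hom[OF i])
  have hom: "limit_embedding i \<in> star_hom A.Q B.Q"
    unfolding limit_embedding_def by (rule C.quotient_lift_star_hom)
  have contr: "cnorm B.Q (limit_embedding i X) \<le> cnorm A.Q X" if "X \<in> carrier A.Q" for X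
    unfolding limit_embedding_def by (rule C.quotient_lift_contractive[OF that])
  have tends: "B.null.quot.tends (\<lambda>n. limit_embedding i (X n)) (limit_embedding i x)" if "A.null.quot.tends X x" for X x
    by (rule contractive_star_hom_tends[OF A.null.normed_star_algebra_quotient
          B.null.normed_star_algebra_quotient hom contr that])
  have union: "limit_embedding i X \<in> B.U" if X: "X \<in> A.U" for X
  proof -
    obtain a x where a: "a \<in> Ki i" "x \<in> carrier (A a)" and eq: "X = limit_map (Ki i) A \<sigma> a x"
      using X by blast
    show ?thesis
      unfolding eq limit_embedding_limit_map[OF i a] using star_homD(1)[OF diag_star_hom[OF i a(1)] a(2)] a(1) by blast
  qed
  have norm_union: "cnorm B.Q (limit_embedding i X) = cnorm A.Q X" if X: "X \<in> A.U" for X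
  proof (rule antisym)
    show "cnorm B.Q (limit_embedding i X) \<le> cnorm A.Q X" by (rule contr[OF A.union.sub_in_carrier[OF X]])
    obtain a x where a: "a \<in> Ki i" "x \<in> carrier (A a)" and eq: "X = limit_map (Ki i) A \<sigma> a x"
      using X by blast
    show "cnorm A.Q X \<le> cnorm B.Q (limit_embedding i X)"
      using limit_embedding_norm_ge[OF i a] by (simp add: eq A_limit_def B_limit_def A.limit_simps B.limit_simps)
  qed
  have approx: "\<exists>Y. (\<forall>n. Y n \<in> A.U) \<and> A.null.quot.tends Y X" if "X \<in> carrier (L i)" for X
    using that A.null.quot.in_closure_iff[OF A.union.sub_carrier] by (simp add: A_limit_def A.limit_simps)
  have mem: "limit_embedding i X \<in> carrier (B_limit I Ki A \<sigma> i)" if X: "X \<in> carrier (L i)" for X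
  proof -
    obtain Y where Y: "\<And>n. Y n \<in> A.U" "A.null.quot.tends Y X" using approx[OF X] by blast
    then show ?thesis
      unfolding B_limit_def B.limit_simps B.null.quot.in_closure_iff[OF B.union.sub_carrier]
      using union tends by (intro exI[of _ "\<lambda>n. limit_embedding i (Y n)"]) simp
  qed
  have "carrier (L i) \<subseteq> carrier A.Q"
    unfolding A_limit_def A.limit_simps by (rule A.lim.sub_carrier)
  then have sub: "X \<in> carrier A.Q" if "X \<in> carrier (L i)" for X using that by blast
  show "limit_embedding i \<in> star_hom (L i) (B_limit I Ki A \<sigma> i)"
    unfolding star_hom_def
    by (simp add: mem) (simp add: A_limit_def B_limit_def A.limit_simps(2-) B.limit_simps(2-) 
        star_homD[OF hom] sub[unfolded A_limit_def])
  show "cnorm (B_limit I Ki A \<sigma> i) (limit_embedding i X) = cnorm (L i) X" if X: "X \<in> carrier (L i)"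
  proof -
    obtain Y where Y: "\<And>n. Y n \<in> A.U" "A.null.quot.tends Y X" using approx[OF X] by blast
    have "(\<lambda>n. cnorm A.Q (Y n)) \<longlonglongrightarrow> cnorm A.Q X" by (rule A.null.quot.tends_norm[OF Y(2)])
    moreover have "(\<lambda>n. cnorm A.Q (Y n)) \<longlonglongrightarrow> cnorm B.Q (limit_embedding i X)"
      using B.null.quot.tends_norm[OF tends[OF Y(2)]] norm_union[OF Y(1)] by simp
    ultimately show ?thesis
      using LIMSEQ_unique by (simp add: A_limit_def B_limit_def A.limit_simps B.limit_simps) blast
  qed
qed

end

lemma normed_star_system_of_cstar:
  assumes sys: "inductive_system K A \<sigma>" and D: "D \<subseteq> K" "upward_directed D"
  shows "normed_star_system D A \<sigma>"
proof -
  have cstar: "unital_cstar_algebra (A a)" if "a \<in> D" for a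
    using sys D that by (auto simp: inductive_system_def)
  have hom: "\<sigma> b a \<in> unital_star_hom (A a) (A b)" if "a \<in> D" "b \<in> D" "a \<le> b" for a b
    using sys D(1) that unfolding inductive_system_def by (meson subsetD)
  show ?thesis
  proof (intro normed_star_system.intro normed_star_algebra_family.intro normed_star_system_axioms.intro)
    show "\<sigma> c a x = \<sigma> c b (\<sigma> b a x)" 
      if "a \<in> D" "b \<in> D" "c \<in> D" "a \<le> b" "b \<le> c" "x \<in> carrier (A a)" for a b c x
      using sys D(1) that unfolding inductive_system_def by (meson subsetD)
    show "cnorm (A b) (\<sigma> b a x) \<le> cnorm (A a) x" if "a \<in> D" "b \<in> D" "a \<le> b" "x \<in> carrier (A a)" for a b x
      using that by (intro unital_star_hom_contractive cstar hom)
    show "normed_star_algebra (A a)" if "a \<in> D" for a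
      by (rule normed_star_algebra_of_cstar[OF cstar[OF that]])
    show "D \<noteq> {}" using D(2) by (simp add: upward_directed_def)
  qed (fact D(2) hom)+
qed

text \<open>Adjoining an element below \<open>b \<in> S\<close> keeps \<open>S\<close> directed, as \<open>b\<close> can stand in for it when upper
bounds are sought; by maximality nothing new was adjoined.\<close>

lemma maximal_directed_downward_closed:
  assumes S: "maximal_directed K S" and b: "b \<in> S" and a: "a \<in> K" "a \<le> b"
  shows "a \<in> S"
proof -
  have dir: "\<exists>z\<in>S. x \<le> z \<and> y \<le> z" if "x \<in> S" "y \<in> S" for x y
    using S that unfolding maximal_directed_def upward_directed_def by blast
  have "\<exists>z\<in>S. x \<le> z \<and> y \<le> z" if xy: "x \<in> insert a S" "y \<in> insert a S" for x y
  proof -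
    define up where "up t = (if t = a then b else t)" for t
    have "up x \<in> S" "up y \<in> S" "x \<le> up x" "y \<le> up y" using xy a b by (auto simp: up_def)
    then show ?thesis using dir by (meson order_trans)
  qed
  then have "upward_directed (insert a S)" unfolding upward_directed_def by blast
  moreover have "insert a S \<subseteq> K" using S a unfolding maximal_directed_def by blast
  ultimately have "insert a S = S" using S unfolding maximal_directed_def by blast
  then show ?thesis by blast
qed

theorem theorem1:
  fixes K :: "'k::order set"
    and I :: "'i set"
    and Ki :: "'i \<Rightarrow> 'k set"
    and A :: "'k \<Rightarrow> 'a cstar_struct"
    and \<sigma> :: "'k \<Rightarrow> 'k \<Rightarrow> 'a \<Rightarrow> 'a"
  assumes "bij_betw Ki I {S. maximal_directed K S}"
    and "inductive_system K A \<sigma>"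
    and "\<And>a b. \<lbrakk>a \<in> K; b \<in> K; a \<le> b\<rbrakk> \<Longrightarrow> inj_on (\<sigma> b a) (carrier (A a))"
  shows "\<forall>i\<in>I. \<exists>S. cstar_subalgebra S (B_limit I Ki A \<sigma> i) \<and>
    star_isomorphic (A_limit Ki A \<sigma> i) ((B_limit I Ki A \<sigma> i)\<lparr>carrier := S\<rparr>)"
proof
  fix i assume i: "i \<in> I"
  have maximal: "maximal_directed K (Ki j)" if "j \<in> I" for j
    using bij_betwE[OF assms(1)] that by blast
  then have Ki: "Ki j \<subseteq> K" "upward_directed (Ki j)" if "j \<in> I" for j
    using that by (auto simp: maximal_directed_def)
  have U: "U_set I Ki b \<subseteq> U_set I Ki a" if "j \<in> I" "a \<in> Ki j" "b \<in> Ki j" "a \<le> b" for j a b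
    using maximal_directed_downward_closed[OF maximal] Ki(1) that unfolding U_set_def by blast
  interpret normed_star_system_family I Ki A \<sigma>
    by (rule normed_star_system_family.intro)
      (use normed_star_system_of_cstar[OF assms(2) Ki] U in blast)+
  interpret A: normed_star_system "Ki i" A \<sigma> by (rule systems[OF i])
  interpret B: normed_star_system "Ki i" B "tau I Ki" by (rule B_system[OF i])
  have "Metric_space.mcomplete (carrier (A a)) (cdist (A a))" if "a \<in> Ki i" for a
    using assms(2) Ki(1)[OF i] that unital_cstar_algebra.complete unfolding inductive_system_def by (meson subsetD)
  then have complete: "Metric_space.mcomplete (carrier (L i)) (cdist (L i))"
    unfolding A_limit_def by (rule A.mcomplete_limit)
  have BL: "normed_star_algebra (B_limit I Ki A \<sigma> i)"
    unfolding B_limit_def by (rule B.normed_star_algebra_limit)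
  note image = isometric_star_hom_image[OF L_algebra[OF i] BL limit_embedding_isometric_star_hom[OF i] complete]
  show "\<exists>S. cstar_subalgebra S (B_limit I Ki A \<sigma> i) \<and>
    star_isomorphic (L i) ((B_limit I Ki A \<sigma> i)\<lparr>carrier := S\<rparr>)"
    using image by blast
qed

end
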